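(* Let $\varphi:=\log\circ\lambda:\Omega^*([0,1])\to C^*_\infty([0,1])$. The corestriction $p\varphi:\overline{T}(\mathbf{s}\Omega^*([0,1]))\to\mathbf{s}C^*([0,1])$ of the $A_\infty$ morphism $\varphi$ (i.e. the map whose restriction to $n$-fold tensors is the Taylor coefficient $\varphi_n$) equals $$p\varphi=(p\lambda)\circ E^*,$$ where $p\lambda:\overline{T}(\mathbf{s}\Omega^*([0,1]))\to\mathbf{s}C^*([0,1])$ is the corestriction of the $A_\infty$ morphism $\lambda$ and $E^*:\overline{T}(\mathbf{s}\Omega^*([0,1]))\to\overline{T}(\mathbf{s}\Omega^*([0,1]))$ is the adjoint of the first Eulerian idempotent.
   Context: **$A_\infty$ conventions.** $\Bbbk$ is a field of characteristic zero. For a graded vector space $V$, $\mathbf{s}V$ is the suspension, $(\mathbf{s}V)^i=V^{i+1}$. $\overline{T}(V)=\bigoplus_{n\ge1}V^{\otimes n}$ carries the deconcatenation coproduct, and $p:\overline{T}(V)\to V$ is the projection. An $A_\infty$ algebra structure on $V$ is a degree $1$ coderivation $Q$ of $\overline{T}(\mathbf{s}V)$ with $Q^2=0$; it is determined by its Taylor coefficients $Q_n:(\mathbf{s}V)^{\otimes n}\to\mathbf{s}V$. An $A_\infty$ morphism $F:V\to W$ is a morphism of dg coalgebras $\overline{T}(\mathbf{s}V)\to\overline{T}(\mathbf{s}W)$, determined by its Taylor coefficients $F_n:(\mathbf{s}V)^{\otimes n}\to\mathbf{s}W$; the composition has coefficients $(G\circ F)_n=\sum_{k}\sum_{i_1+\cdots+i_k=n}G_k(F_{i_1}\otimes\cdots\otimes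 F_{i_k})$. A dg algebra is an $A_\infty$ algebra via $Q_1(\mathbf{s}a)=-\mathbf{s}(da)$, $Q_2(\mathbf{s}a\otimes\mathbf{s}b)=(-1)^{|a|}\mathbf{s}(ab)$, $Q_n=0$ for $n\ge3$. **Shuffle product and $E^*$.** On $\overline{T}(V)$, for a graded space $V$, $(v_1\otimes\cdots\otimes v_p)\circledast(v_{p+1}\otimes\cdots\otimes v_n)=\sum_{\sigma}\varepsilon(\sigma)v_{\sigma^{-1}(1)}\otimes\cdots\otimes v_{\sigma^{-1}(n)}$, where $\sigma\in S_n$ ranges over the permutations with $\sigma(i)<\sigma(i+1)$ for all $i\ne p$, and $\varepsilon(\sigma)$ is the Koszul sign. The map $E^*:\overline{T}(V)\to\overline{T}(V)$ is $$E^*(v_1\otimes\cdots\otimes v_n)=v_1\otimes\cdots\otimes v_n+\sum_{k=2}^n\frac{(-1)^{k+1}}{k}\sum_{i_1+\cdots+i_k=n}(v_1\otimes\cdots\otimes v_{i_1})\circledast\cdots\circledast(v_{i_1+\cdots+i_{k-1}+1}\otimes\cdots\otimes v_n),$$ (sum over ordered partitions into positive integers). When $V$ is concentrated in degree zero, $E^*(v_1\otimes\cdots\otimes v_n)=\sum_{\sigma\in S_n}\frac{(-1)^{d_\sigma}}{n\binom{n-1}{d_\sigma}}v_{\sigma^{-1}(1)}\otimes\cdots\otimes v_{\sigma^{-1}(n)}$ with $d_\sigma$ the number of descents of $\sigma$; it is the adjoint, with respect to the scalar product making the tensor basis induced by a basis of $V$ orthonormal, of the Eulerian projector $E(v_1\otimes\cdots\otimes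 v_n)=\sum_{\sigma\in S_n}\frac{(-1)^{d_\sigma}}{n\binom{n-1}{d_\sigma}}v_{\sigma(1)}\otimes\cdots\otimes v_{\sigma(n)}$. **Forms and cochains.** $\Omega^*([0,1])$ is either the commutative dg algebra of smooth real forms on $[0,1]$ ($\Bbbk=\mathbb{R}$) or that of polynomial forms $\Bbbk[t]\oplus\Bbbk[t]dt$ (with polynomial integrals over simplices evaluated formally). $C^*([0,1])\subset\Omega^*([0,1])$ is the subcomplex of Whitney forms $\{at+b(1-t)\}\oplus\{c\,dt\}$, $a,b,c\in\Bbbk$. $C^*_\cup([0,1])$ is the dg algebra $(C^*([0,1]),d,\cup)$ with unit the constant function $1$ and $t\cup t=t$, $t\cup dt=0$, $dt\cup t=dt$. $C^*_\infty([0,1])$ is $C^*([0,1])$ with the $C_\infty$ (in particular $A_\infty$) structure, unital with respect to $1$, with Taylor coefficients: $m_1(\mathbf{s}t)=-\mathbf{s}dt$, $m_2(\mathbf{s}t\otimes\mathbf{s}t)=\mathbf{s}t$, $m_2(\mathbf{s}t\otimes\mathbf{s}dt)=\frac12\mathbf{s}dt=-m_2(\mathbf{s}dt\otimes\mathbf{s}t)$, and for $n>1$, $m_{n+1}$ vanishes unless precisely one argument is a function, with $m_{n+1}((\mathbf{s}dt)^{\otimes i}\otimes\mathbf{s}t\otimes(\mathbf{s}dt)^{\otimes n-i})=(-1)^{i+1}\binom{n}{i}\frac{B_n}{n!}\mathbf{s}dt$, where $\frac{z}{e^z-1}=\sum_{n\ge0}\frac{B_n}{n!}z^n$. **The morphism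 $\lambda$** is the $A_\infty$ morphism $\Omega^*([0,1])\to C^*_\cup([0,1])$ with $\lambda_1=\pi$, where $\pi(f)=f(1)t+f(0)(1-t)$ on functions and $\pi(a(t)dt)=\left(\int_0^1a(\tau)d\tau\right)dt$; for $n>1$, $\lambda_n$ vanishes if some factor is a zero-form; and $\lambda_n(\mathbf{s}a_1(t)dt\otimes\cdots\otimes\mathbf{s}a_n(t)dt)=\left(\int_{0\le t_1\le\cdots\le t_n\le1}a_1(t_1)\cdots a_n(t_n)dt_1\cdots dt_n\right)\mathbf{s}dt$ for $n\ge1$. **The morphism $\log$** is the $A_\infty$ isomorphism $C^*_\cup([0,1])\to C^*_\infty([0,1])$ with $\log_1=\mathrm{id}$, $\log_n$ ($n>1$) vanishing if some factor is a zero-form, and $\log_n((\mathbf{s}dt)^{\otimes n})=\frac{(-1)^{n+1}}{n}\mathbf{s}dt$ for $n\ge1$. *)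

theory Defs
  imports
    "HOL-Analysis.Analysis"
    "HOL-Library.Poly_Mapping"
    "HOL-Library.Function_Algebras"
    "HOL-Computational_Algebra.Polynomial"
    "HOL-Combinatorics.Permutations"
begin

section \<open>Graded vector spaces and the reduced tensor coalgebra\<close>

text \<open>A graded vector space is the (internal) direct sum of the subspaces \<open>piece V d\<close> of \<open>'v\<close>,
  with scalar multiplication \<open>scl V\<close>.  The suspension does not change the underlying vectors.\<close>

record ('k, 'v) graded_space =
  scl :: "'k \<Rightarrow> 'v \<Rightarrow> 'v"
  piece :: "int \<Rightarrow> 'v set"

definition susp :: "('k, 'v) graded_space \<Rightarrow> ('k, 'v) graded_space" where
  "susp V = V\<lparr>piece := (\<lambda>i. piece V (i + 1))\<rparr>"

text \<open>The reduced tensor coalgebra is the free vector space on the nonempty words of homogeneous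
  elements, modulo multilinearity.  A letter is a homogeneous element together with its degree;
  the word \<open>[(d\<^sub>1, v\<^sub>1), \<dots>, (d\<^sub>n, v\<^sub>n)]\<close> stands for the tensor \<open>v\<^sub>1 \<otimes> \<dots> \<otimes> v\<^sub>n\<close>.\<close>

type_synonym 'v word = "(int \<times> 'v) list"
type_synonym ('k, 'v) formal = "(int \<times> 'v) list \<Rightarrow>\<^sub>0 'k"

definition words :: "('k, 'v) graded_space \<Rightarrow> 'v word set" where
  "words V = {w. w \<noteq> [] \<and> (\<forall>(d, v) \<in> set w. v \<in> piece V d)}"

definition word_degree :: "'v word \<Rightarrow> int" where
  "word_degree w = sum_list (map fst w)"

definition fscale :: "'k::field \<Rightarrow> ('b \<Rightarrow>\<^sub>0 'k) \<Rightarrow> ('b \<Rightarrow>\<^sub>0 'k)" where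
  "fscale c x = Poly_Mapping.map ((*) c) x"

lemma lookup_fscale: "Poly_Mapping.lookup (fscale c x) k = c * Poly_Mapping.lookup x k"
  by (simp add: fscale_def Poly_Mapping.map.rep_eq when_def)

lemma module_fscale: "module (fscale :: 'k::field \<Rightarrow> ('b \<Rightarrow>\<^sub>0 'k) \<Rightarrow> ('b \<Rightarrow>\<^sub>0 'k))"
  by unfold_locales
    (auto intro!: poly_mapping_eqI simp: lookup_fscale lookup_add algebra_simps)

definition fword :: "'b \<Rightarrow> ('b \<Rightarrow>\<^sub>0 'k::field)" where
  "fword w = Poly_Mapping.single w 1"

definition formal_space :: "('k::field, 'v) graded_space \<Rightarrow> ('k, 'v) formal set" where
  "formal_space V = {x. Poly_Mapping.keys x \<subseteq> words V}"

inductive_set multilinear_rel ::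
    "('k::field, 'v::ab_group_add) graded_space \<Rightarrow> ('k, 'v) formal set"
  for V :: "('k::field, 'v::ab_group_add) graded_space" where
  add: "\<lbrakk>a @ [(d, v)] @ b \<in> words V; a @ [(d, v')] @ b \<in> words V\<rbrakk> \<Longrightarrow>
      fword (a @ [(d, v + v')] @ b) - fword (a @ [(d, v)] @ b) - fword (a @ [(d, v')] @ b)
        \<in> multilinear_rel V"
| scale: "a @ [(d, v)] @ b \<in> words V \<Longrightarrow>
      fword (a @ [(d, scl V c v)] @ b) - fscale c (fword (a @ [(d, v)] @ b))
        \<in> multilinear_rel V"

definition tensor_cong ::
    "('k::field, 'v::ab_group_add) graded_space \<Rightarrow> (('k, 'v) formal \<times> ('k, 'v) formal) set" where
  "tensor_cong V = {(x, y). x \<in> formal_space V \<and> y \<in> formal_space V \<and>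
     x - y \<in> module.span fscale (multilinear_rel V)}"

definition Tbar :: "('k::field, 'v::ab_group_add) graded_space \<Rightarrow> ('k, 'v) formal set set" where
  "Tbar V = formal_space V // tensor_cong V"

text \<open>Linear maps out of \<open>Tbar V\<close> are given by their values on words: \<open>tensor_map W g\<close> is
  the map \<open>Tbar V \<rightarrow> Tbar W\<close> induced by \<open>g\<close>, provided that \<open>g\<close> is multilinear modulo
  \<open>tensor_cong W\<close>.\<close>

definition lin_ext :: "('b \<Rightarrow> ('c \<Rightarrow>\<^sub>0 'k::field)) \<Rightarrow> ('b \<Rightarrow>\<^sub>0 'k) \<Rightarrow> ('c \<Rightarrow>\<^sub>0 'k)" where
  "lin_ext g x = (\<Sum>w\<in>Poly_Mapping.keys x. fscale (Poly_Mapping.lookup x w) (g w))"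

definition tensor_map ::
    "('k::field, 'w::ab_group_add) graded_space \<Rightarrow> ('v word \<Rightarrow> ('k, 'w) formal)
      \<Rightarrow> ('k, 'v) formal set \<Rightarrow> ('k, 'w) formal set" where
  "tensor_map W g X = tensor_cong W `` (lin_ext g ` X)"

definition proj ::
    "('k::field, 'v::ab_group_add) graded_space \<Rightarrow> ('k, 'v) formal set \<Rightarrow> 'v" where
  "proj V X = the_elem ((\<lambda>x. \<Sum>w\<in>Poly_Mapping.keys x. scl V (Poly_Mapping.lookup x w)
     (if length w = 1 then snd (hd w) else 0)) ` X)"

definition corestriction ::
    "('k::field, 'w::ab_group_add) graded_space \<Rightarrow> ('t \<Rightarrow> ('k, 'w) formal set) \<Rightarrow> 't \<Rightarrow> 'w" where
  "corestriction W F = proj W \<circ> F"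

text \<open>Ordered decompositions \<open>i\<^sub>1 + \<dots> + i\<^sub>k = length w\<close> into positive integers, recorded as
  the corresponding blocks of \<open>w\<close>.\<close>

definition cuts :: "nat \<Rightarrow> 'b list \<Rightarrow> 'b list list set" where
  "cuts k w = {ws. length ws = k \<and> concat ws = w \<and> [] \<notin> set ws}"

text \<open>The coalgebra morphism with Taylor coefficients \<open>f\<close> (of degree 0): it sends a word to the
  sum over all \<open>k\<close> of \<open>f\<^bsub>i\<^sub>1\<^esub> \<otimes> \<dots> \<otimes> f\<^bsub>i\<^sub>k\<^esub>\<close>.  No Koszul signs occur since the
  \<open>f\<^sub>i\<close> have degree 0; for the same reason the degree of \<open>f b\<close> is that of \<open>b\<close>.
  Composition of A-infinity morphisms is composition of these maps, so the codifferentials play no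
  role for it.\<close>

definition coalg_morphism ::
    "('k::field, 'w::ab_group_add) graded_space \<Rightarrow> ('v word \<Rightarrow> 'w)
      \<Rightarrow> ('k, 'v) formal set \<Rightarrow> ('k, 'w) formal set" where
  "coalg_morphism W f = tensor_map W (\<lambda>w.
     \<Sum>k=1..length w. \<Sum>ws\<in>cuts k w. fword (map (\<lambda>b. (word_degree b, f b)) ws))"


section \<open>The shuffle product and the map \<open>E\<^sup>*\<close>\<close>

text \<open>Positions are counted from 0, so the condition at \<open>i \<noteq> p\<close> for 1-based \<open>i\<close> becomes
  \<open>Suc i \<noteq> p\<close>.\<close>

definition shuffle_perms :: "nat \<Rightarrow> nat \<Rightarrow> (nat \<Rightarrow> nat) set" where
  "shuffle_perms p n = {\<sigma>. \<sigma> permutes {..<n} \<and>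
     (\<forall>i. Suc i < n \<and> Suc i \<noteq> p \<longrightarrow> \<sigma> i < \<sigma> (Suc i))}"

definition koszul_sign :: "(nat \<Rightarrow> nat) \<Rightarrow> 'v word \<Rightarrow> 'k::field" where
  "koszul_sign \<sigma> w = (\<Prod>(i, j) \<in> {(i, j). i < j \<and> j < length w \<and> \<sigma> j < \<sigma> i}.
     if odd (fst (w ! i) * fst (w ! j)) then - 1 else 1)"

definition shuffle_words :: "'v word \<Rightarrow> 'v word \<Rightarrow> ('k::field, 'v) formal" where
  "shuffle_words u v = (let w = u @ v; n = length w in
     \<Sum>\<sigma>\<in>shuffle_perms (length u) n.
       fscale (koszul_sign \<sigma> w) (fword (map (\<lambda>i. w ! (inv \<sigma> i)) [0..<n])))"

definition shuffle :: "('k::field, 'v) formal \<Rightarrow> ('k, 'v) formal \<Rightarrow> ('k, 'v) formal" where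
  "shuffle x y = lin_ext (\<lambda>u. lin_ext (\<lambda>v. shuffle_words u v) y) x"

definition shuffle_list :: "'v word list \<Rightarrow> ('k::field, 'v) formal" where
  "shuffle_list ws = foldl shuffle (fword (hd ws)) (map fword (tl ws))"

definition eulerian_adj_word :: "'v word \<Rightarrow> ('k::field_char_0, 'v) formal" where
  "eulerian_adj_word w = fword w +
     (\<Sum>k=2..length w. fscale ((-1) ^ (k + 1) / of_nat k) (\<Sum>ws\<in>cuts k w. shuffle_list ws))"

definition eulerian_adj ::
    "('k::field_char_0, 'v::ab_group_add) graded_space
      \<Rightarrow> ('k, 'v) formal set \<Rightarrow> ('k, 'v) formal set" where
  "eulerian_adj V = tensor_map V eulerian_adj_word"


section \<open>Differential forms on the unit interval\<close>

text \<open>The two versions of forms on \<open>[0,1]\<close> (polynomial, smooth) share the following data;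
  \<open>simplex_int [a\<^sub>1, \<dots>, a\<^sub>n]\<close> is the integral of \<open>a\<^sub>1(t\<^sub>1) \<dots> a\<^sub>n(t\<^sub>n)\<close> over
  \<open>0 \<le> t\<^sub>1 \<le> \<dots> \<le> t\<^sub>n \<le> 1\<close>.\<close>

record ('k, 'f) functions01 =
  fns :: "'f set"
  smul :: "'k \<Rightarrow> 'f \<Rightarrow> 'f"
  unit_fn :: 'f
  coord_fn :: 'f
  eval_fn :: "'f \<Rightarrow> 'k \<Rightarrow> 'k"
  int01 :: "'f \<Rightarrow> 'k"
  simplex_int :: "'f list \<Rightarrow> 'k"

definition poly_primitive :: "'k::field_char_0 poly \<Rightarrow> 'k poly" where
  "poly_primitive p = (\<Sum>i\<le>degree p. monom (coeff p i / of_nat (i + 1)) (i + 1))"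

definition poly_functions :: "('k::field_char_0, 'k poly) functions01" where
  "poly_functions =
    \<lparr>fns = UNIV,
     smul = smult,
     unit_fn = 1,
     coord_fn = [:0, 1:],
     eval_fn = poly,
     int01 = (\<lambda>a. poly (poly_primitive a) 1),
     simplex_int = (\<lambda>as. poly (foldl (\<lambda>P a. poly_primitive (a * P)) 1 as) 1)\<rparr>"

text \<open>Functions on \<open>[0,1]\<close> are extended by zero, so that equality on \<open>[0,1]\<close> is equality in
  \<open>real \<Rightarrow> real\<close>; derivatives at the end points are one-sided.\<close>

definition smooth01 :: "(real \<Rightarrow> real) set" where
  "smooth01 = {f. (\<forall>x. x \<notin> {0..1} \<longrightarrow> f x = 0) \<and>
     (\<exists>D :: nat \<Rightarrow> real \<Rightarrow> real. D 0 = f \<and>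
       (\<forall>n. \<forall>x\<in>{0..1}. (D n has_real_derivative D (Suc n) x) (at x within {0..1})))}"

definition ordered_simplex :: "nat \<Rightarrow> (nat \<Rightarrow> real) set" where
  "ordered_simplex n = {t \<in> {..<n} \<rightarrow>\<^sub>E UNIV.
     (\<forall>i<n. 0 \<le> t i \<and> t i \<le> 1) \<and> (\<forall>i j. i \<le> j \<and> j < n \<longrightarrow> t i \<le> t j)}"

definition smooth_functions :: "(real, real \<Rightarrow> real) functions01" where
  "smooth_functions =
    \<lparr>fns = smooth01,
     smul = (\<lambda>c f x. c * f x),
     unit_fn = indicator {0..1},
     coord_fn = (\<lambda>x. if x \<in> {0..1} then x else 0),
     eval_fn = (\<lambda>f x. f x),
     int01 = (\<lambda>a. integral {0..1} a),
     simplex_int = (\<lambda>as. let n = length as in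
       LINT t:ordered_simplex n|PiM {..<n} (\<lambda>_. lborel). \<Prod>i<n. (as ! i) (t i))\<rparr>"

text \<open>The pair \<open>(f, a)\<close> stands for the form \<open>f + a dt\<close>.\<close>

definition form_scale :: "('k, 'f) functions01 \<Rightarrow> 'k \<Rightarrow> 'f \<times> 'f \<Rightarrow> 'f \<times> 'f" where
  "form_scale M c \<omega> = (smul M c (fst \<omega>), smul M c (snd \<omega>))"

definition Omega :: "('k, 'f::ab_group_add) functions01 \<Rightarrow> ('k, 'f \<times> 'f) graded_space" where
  "Omega M =
    \<lparr>scl = form_scale M,
     piece = (\<lambda>d. if d = 0 then {(f, 0) | f. f \<in> fns M}
                  else if d = 1 then {(0, a) | a. a \<in> fns M} else {0})\<rparr>"

definition whitney0 :: "('k::field, 'f::ab_group_add) functions01 \<Rightarrow> 'k \<Rightarrow> 'k \<Rightarrow> 'f \<times> 'f" where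
  "whitney0 M a b = (smul M a (coord_fn M) + smul M b (unit_fn M - coord_fn M), 0)"

definition whitney1 :: "('k::field, 'f::ab_group_add) functions01 \<Rightarrow> 'k \<Rightarrow> 'f \<times> 'f" where
  "whitney1 M c = (0, smul M c (unit_fn M))"

text \<open>The space of Whitney forms, which underlies both the cup product algebra
  and the C-infinity algebra.\<close>

definition Whitney ::
    "('k::field, 'f::ab_group_add) functions01 \<Rightarrow> ('k, 'f \<times> 'f) graded_space" where
  "Whitney M =
    \<lparr>scl = form_scale M,
     piece = (\<lambda>d. if d = 0 then {whitney0 M a b | a b. True}
                  else if d = 1 then {whitney1 M c | c. True} else {0})\<rparr>"


section \<open>The morphisms \<open>\<lambda>\<close> and \<open>log\<close>\<close>

text \<open>In the suspended spaces functions have degree \<open>-1\<close> and one-forms have degree \<open>0\<close>.\<close>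

definition whitney_proj ::
    "('k::field, 'f::ab_group_add) functions01 \<Rightarrow> 'f \<times> 'f \<Rightarrow> 'f \<times> 'f" where
  "whitney_proj M \<omega> = whitney0 M (eval_fn M (fst \<omega>) 1) (eval_fn M (fst \<omega>) 0)
     + whitney1 M (int01 M (snd \<omega>))"

definition lambda_taylor ::
    "('k::field, 'f::ab_group_add) functions01 \<Rightarrow> ('f \<times> 'f) word \<Rightarrow> 'f \<times> 'f" where
  "lambda_taylor M w =
    (if length w = 1 then whitney_proj M (snd (hd w))
     else if \<forall>(d, \<omega>) \<in> set w. d = 0
       then whitney1 M (simplex_int M (map (\<lambda>(d, \<omega>). snd \<omega>) w))
     else 0)"

definition lambda_morphism ::
    "('k::field, 'f::ab_group_add) functions01
      \<Rightarrow> ('k, 'f \<times> 'f) formal set \<Rightarrow> ('k, 'f \<times> 'f) formal set" where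
  "lambda_morphism M = coalg_morphism (susp (Whitney M)) (lambda_taylor M)"

definition log_taylor ::
    "('k::field_char_0, 'f::ab_group_add) functions01 \<Rightarrow> ('f \<times> 'f) word \<Rightarrow> 'f \<times> 'f" where
  "log_taylor M w =
    (if length w = 1 then snd (hd w)
     else if \<forall>(d, \<omega>) \<in> set w. d = 0
       then whitney1 M ((-1) ^ (length w + 1) / of_nat (length w)
              * (\<Prod>(d, \<omega>)\<leftarrow>w. (THE c. \<omega> = whitney1 M c)))
     else 0)"

definition log_morphism ::
    "('k::field_char_0, 'f::ab_group_add) functions01
      \<Rightarrow> ('k, 'f \<times> 'f) formal set \<Rightarrow> ('k, 'f \<times> 'f) formal set" where
  "log_morphism M = coalg_morphism (susp (Whitney M)) (log_taylor M)"

definition phi_morphism ::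
    "('k::field_char_0, 'f::ab_group_add) functions01
      \<Rightarrow> ('k, 'f \<times> 'f) formal set \<Rightarrow> ('k, 'f \<times> 'f) formal set" where
  "phi_morphism M = log_morphism M \<circ> lambda_morphism M"

end

theory Submission
  imports Defs
begin

text \<open>Since all Taylor coefficients have degree 0, no signs enter, and the Taylor coefficient of
  \<open>log \<circ> \<lambda>\<close> on a word \<open>w\<close> is the sum of \<open>log\<^sub>k (\<lambda> w\<^sub>1 \<otimes> \<dots> \<otimes> \<lambda> w\<^sub>k)\<close> over all ways to cut
  \<open>w\<close> into nonempty blocks \<open>w\<^sub>1, \<dots>, w\<^sub>k\<close>.  On a word of one-forms each \<open>\<lambda> w\<^sub>i\<close> is an iterated
  integral times \<open>dt\<close>, and \<open>log\<^sub>k\<close> multiplies these \<open>k\<close> scalars together with \<open>(-1)\<^sup>k\<^sup>+\<^sup>1 / k\<close>.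
  The other side is \<open>\<lambda>\<close> evaluated on \<open>(-1)\<^sup>k\<^sup>+\<^sup>1 / k\<close> times the shuffle product of the same blocks,
  summed over the same cuts.  The two sides therefore agree term by term, because the product
  of iterated integrals is the iterated integral of the shuffle product (Ree's identity,
  \<open>word_int_shuffle_list\<close>).  On longer words with a letter that is not a one-form, both
  sides vanish (\<open>log_taylor_lambda_blocks\<close>).

  One-forms have degree 0 after suspension, so their shuffles carry no Koszul signs, and Ree's
  identity comes down to integration by parts for \<open>J f = \<integral>\<^sub>0 f\<close>,
  \<open>J f * J g = J (f * J g) + J (J f * g)\<close>.  With iterated integrals written as nested
  applications of \<open>J\<close>, the product of two of them obeys the recursion that generates the shuffles of
  two lists (\<open>sum_iter_rev_shuffles\<close>).  The locale \<open>iterated_integrals\<close> isolates this structure.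
  Polynomials carry it by comparison of coefficients; for smooth functions Fubini's theorem turns
  the integral over the simplex into nested applications of \<open>J\<close>
  (\<open>simplex_integral_eq_iterated\<close>).

  The tensor coalgebra is a quotient of formal sums of words, and the maps out of it act on
  representatives.  It suffices to compare both sides on single words: once the Taylor
  coefficients of \<open>\<lambda>\<close> and \<open>log\<close> are multilinear, their linear extensions are constant on classes,
  so passing through an intermediate class does not change the set of values
  (\<open>image_linear_eval_tensor_map\<close>).\<close>

section \<open>Linear evaluation of formal sums of words\<close>

text \<open>The projection onto words of length one, the extension of a Taylor coefficient and the map
  \<open>lin_ext\<close> are all linear extensions of a function on words; a common target module makes one set
  of lemmas serve for all three.\<close>

definition linear_eval ::
    "('k::field \<Rightarrow> 'm::ab_group_add \<Rightarrow> 'm) \<Rightarrow> ('b \<Rightarrow> 'm) \<Rightarrow> ('b \<Rightarrow>\<^sub>0 'k) \<Rightarrow> 'm" where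
  "linear_eval s f x = (\<Sum>w\<in>Poly_Mapping.keys x. s (Poly_Mapping.lookup x w) (f w))"

lemma lin_ext_eq_linear_eval: "lin_ext g = linear_eval fscale g"
  by (simp add: lin_ext_def linear_eval_def fun_eq_iff)

lemma linear_eval_superset:
  assumes "module s" "finite S" "Poly_Mapping.keys x \<subseteq> S"
  shows "linear_eval s f x = (\<Sum>w\<in>S. s (Poly_Mapping.lookup x w) (f w))"
proof -
  interpret module s by fact
  show ?thesis
    unfolding linear_eval_def
    by (rule sum.mono_neutral_left) (use assms in \<open>auto simp: in_keys_iff\<close>)
qed

lemma linear_eval_cong:
  assumes "\<And>w. w \<in> Poly_Mapping.keys x \<Longrightarrow> f w = g w"
  shows "linear_eval s f x = linear_eval s g x"
  unfolding linear_eval_def using assms by (intro sum.cong) auto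

lemma module_hom_linear_eval:
  assumes "module s"
  shows "module_hom fscale s (linear_eval s f)"
proof -
  interpret module s by fact
  interpret fs: module "fscale :: 'a \<Rightarrow> ('c \<Rightarrow>\<^sub>0 'a) \<Rightarrow> _" by (rule module_fscale)
  show ?thesis
  proof
    fix x y :: "'c \<Rightarrow>\<^sub>0 'a" and c
    let ?S = "Poly_Mapping.keys x \<union> Poly_Mapping.keys y"
    have *: "linear_eval s f z = (\<Sum>w\<in>?S. s (Poly_Mapping.lookup z w) (f w))"
      if "Poly_Mapping.keys z \<subseteq> ?S" for z
      by (rule linear_eval_superset[OF assms _ that]) auto
    have "Poly_Mapping.keys (x + y) \<subseteq> ?S"
      by (rule Poly_Mapping.keys_add)
    then show "linear_eval s f (x + y) = linear_eval s f x + linear_eval s f y"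
      by (simp add: * lookup_add scale_left_distrib sum.distrib)
    have "Poly_Mapping.keys (fscale c x) \<subseteq> ?S"
      by (auto simp: in_keys_iff lookup_fscale)
    then show "linear_eval s f (fscale c x) = s c (linear_eval s f x)"
      by (simp add: * lookup_fscale scale_sum_right)
  qed
qed

lemma linear_eval_fword:
  assumes "module s"
  shows "linear_eval s f (fword w) = f w"
proof -
  interpret module s by fact
  show ?thesis by (simp add: linear_eval_def fword_def)
qed

lemma lin_ext_fword [simp]: "lin_ext g (fword w) = g w"
  by (simp add: lin_ext_eq_linear_eval linear_eval_fword module_fscale)

lemma linear_eval_lin_ext:
  assumes "module s"
  shows "linear_eval s f (lin_ext g x) = linear_eval s (\<lambda>w. linear_eval s f (g w)) x"
proof -
  interpret module_hom fscale s "linear_eval s f" by (rule module_hom_linear_eval[OF assms])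
  show ?thesis
    unfolding lin_ext_def sum scale by (simp add: linear_eval_def[of s _ x])
qed

definition supported_on :: "'b set \<Rightarrow> ('b \<Rightarrow>\<^sub>0 'k::field) set" where
  "supported_on S = {x. Poly_Mapping.keys x \<subseteq> S}"

lemma formal_space_eq_supported_on: "formal_space V = supported_on (words V)"
  by (simp add: formal_space_def supported_on_def)

lemma supported_on_add: "x \<in> supported_on S \<Longrightarrow> y \<in> supported_on S \<Longrightarrow> x + y \<in> supported_on S"
  using Poly_Mapping.keys_add[of x y] by (auto simp: supported_on_def)

lemma supported_on_fscale: "x \<in> supported_on S \<Longrightarrow> fscale c x \<in> supported_on S"
  by (auto simp: supported_on_def in_keys_iff lookup_fscale)

lemma supported_on_sum:
  "(\<And>i. i \<in> I \<Longrightarrow> f i \<in> supported_on S) \<Longrightarrow> (\<Sum>i\<in>I. f i) \<in> supported_on S"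
  by (induction I rule: infinite_finite_induct)
    (auto intro: supported_on_add simp: supported_on_def[of _, THEN eqset_imp_iff, of 0])

lemma supported_on_fword: "w \<in> S \<Longrightarrow> fword w \<in> supported_on S"
  by (simp add: supported_on_def fword_def)

lemma supported_on_lin_ext:
  assumes "x \<in> supported_on S" "\<And>w. w \<in> S \<Longrightarrow> g w \<in> supported_on T"
  shows "lin_ext g x \<in> supported_on T"
  unfolding lin_ext_def
  using assms by (intro supported_on_sum supported_on_fscale) (auto simp: supported_on_def)

text \<open>These are the equations that a function on words must satisfy in order to kill the generators
  in \<open>multilinear_rel\<close>.  They are required only for words with homogeneous letters.\<close>

definition multilinear_on ::
    "('k::field, 'v::ab_group_add) graded_space \<Rightarrow> ('k \<Rightarrow> 'm::ab_group_add \<Rightarrow> 'm)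
      \<Rightarrow> ('v word \<Rightarrow> 'm) \<Rightarrow> bool" where
  "multilinear_on V s f \<longleftrightarrow>
    (\<forall>a d v v' b. a @ [(d, v)] @ b \<in> words V \<longrightarrow> a @ [(d, v')] @ b \<in> words V \<longrightarrow>
       f (a @ [(d, v + v')] @ b) = f (a @ [(d, v)] @ b) + f (a @ [(d, v')] @ b)) \<and>
    (\<forall>a d v b c. a @ [(d, v)] @ b \<in> words V \<longrightarrow>
       f (a @ [(d, scl V c v)] @ b) = s c (f (a @ [(d, v)] @ b)))"

lemma linear_eval_tensor_cong:
  assumes s: "module s" and f: "multilinear_on V s f" and xy: "(x, y) \<in> tensor_cong V"
  shows "linear_eval s f x = linear_eval s f y"
proof -
  interpret module_hom fscale s "linear_eval s f" by (rule module_hom_linear_eval[OF s])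
  have "linear_eval s f z = 0" if "z \<in> multilinear_rel V" for z
    using that
    by cases (use f in \<open>auto simp: diff scale linear_eval_fword[OF s] multilinear_on_def\<close>)
  moreover have "x - y \<in> m1.span (multilinear_rel V)"
    using xy unfolding tensor_cong_def mem_Collect_eq prod.case by (elim conjE)
  ultimately have "linear_eval s f (x - y) = 0"
    by (rule eq_0_on_span)
  then show ?thesis by (simp add: diff)
qed

lemma tensor_cong_refl: "x \<in> formal_space V \<Longrightarrow> (x, x) \<in> tensor_cong V"
  by (simp add: tensor_cong_def module.span_zero[OF module_fscale])

text \<open>A class in the image of \<open>tensor_map\<close> contains many formal sums that are not of the form
  \<open>lin_ext g x\<close>, but a multilinear \<open>f\<close> cannot distinguish them from those.  Hence values can be
  computed on the given representatives.\<close>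

lemma image_linear_eval_tensor_map:
  assumes s: "module s" and f: "multilinear_on W s f"
    and g: "\<And>x. x \<in> X \<Longrightarrow> lin_ext g x \<in> formal_space W"
  shows "linear_eval s f ` tensor_map W g X
    = (\<lambda>x. linear_eval s f (lin_ext g x)) ` X"
proof (intro equalityI subsetI)
  fix r assume "r \<in> linear_eval s f ` tensor_map W g X"
  then obtain x z where "x \<in> X" "(lin_ext g x, z) \<in> tensor_cong W" "r = linear_eval s f z"
    by (auto simp: tensor_map_def)
  then show "r \<in> (\<lambda>x. linear_eval s f (lin_ext g x)) ` X"
    using linear_eval_tensor_cong[OF s f, of "lin_ext g x" z] by (intro image_eqI[of _ _ x]) simp_all
next
  fix r assume "r \<in> (\<lambda>x. linear_eval s f (lin_ext g x)) ` X"
  then obtain x where x: "x \<in> X" "r = linear_eval s f (lin_ext g x)" by blast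
  then have "lin_ext g x \<in> tensor_map W g X"
    using tensor_cong_refl[OF g[OF x(1)]] by (auto simp: tensor_map_def)
  with x(2) show "r \<in> linear_eval s f ` tensor_map W g X" by blast
qed

lemma Tbar_subset_formal_space: "X \<in> Tbar V \<Longrightarrow> X \<subseteq> formal_space V"
  by (auto simp: Tbar_def quotient_def tensor_cong_def)

lemma tensor_map_subset_formal_space: "tensor_map W g X \<subseteq> formal_space W"
  by (auto simp: tensor_map_def tensor_cong_def)

lemma cuts_one: "w \<noteq> [] \<Longrightarrow> cuts 1 w = {[w]}"
  by (auto simp: cuts_def length_Suc_conv)

lemma cuts_block_in_words:
  "w \<in> words V \<Longrightarrow> ws \<in> cuts k w \<Longrightarrow> b \<in> set ws \<Longrightarrow> b \<in> words V"
  by (fastforce simp: words_def cuts_def)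

definition single_letter :: "'v::ab_group_add word \<Rightarrow> 'v" where
  "single_letter w = (if length w = 1 then snd (hd w) else 0)"

lemma proj_eq: "proj V X = the_elem (linear_eval (scl V) single_letter ` X)"
  by (simp add: proj_def linear_eval_def single_letter_def)

lemma multilinear_single_letter:
  assumes "module (scl V)" shows "multilinear_on V (scl V) single_letter"
proof -
  interpret module "scl V" by fact
  show ?thesis by (auto simp: multilinear_on_def single_letter_def Cons_eq_append_conv)
qed

lemma supported_on_coalg_morphism:
  assumes f: "\<And>w. w \<in> words V \<Longrightarrow> f w \<in> piece W (word_degree w)"
    and x: "x \<in> supported_on (words V)"
  shows "lin_ext (\<lambda>w. \<Sum>k=1..length w. \<Sum>ws\<in>cuts k w.
    fword (map (\<lambda>b. (word_degree b, f b)) ws)) x \<in> supported_on (words W)"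
proof (rule supported_on_lin_ext[OF x])
  fix w assume w: "w \<in> words V"
  show "(\<Sum>k=1..length w. \<Sum>ws\<in>cuts k w. fword (map (\<lambda>b. (word_degree b, f b)) ws))
      \<in> supported_on (words W)"
    using f cuts_block_in_words[OF w]
    by (intro supported_on_sum supported_on_fword) (force simp: words_def cuts_def)
qed

text \<open>Only the decomposition of a word into a single block contributes a word of length one, so
  projecting the coalgebra morphism recovers its Taylor coefficients.\<close>

lemma the_elem_corestriction_coalg_morphism:
  assumes W: "module (scl W)"
    and f: "\<And>w. w \<in> words V \<Longrightarrow> f w \<in> piece W (word_degree w)"
    and X: "X \<subseteq> formal_space V"
  shows "corestriction W (coalg_morphism W f) X = the_elem (linear_eval (scl W) f ` X)"
proof -
  let ?g = "\<lambda>w. \<Sum>k=1..length w. \<Sum>ws\<in>cuts k w. fword (map (\<lambda>b. (word_degree b, f b)) ws) :: ('a, 'b) formal"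
  interpret module "scl W" by fact
  interpret module_hom fscale "scl W" "linear_eval (scl W) single_letter"
    by (rule module_hom_linear_eval[OF W])
  have g: "lin_ext ?g x \<in> formal_space W" if "x \<in> X" for x
    using that X unfolding formal_space_eq_supported_on
    by (intro supported_on_coalg_morphism[where V = V] f) auto
  have "linear_eval (scl W) single_letter (?g w) = f w" if "w \<in> words V" for w
  proof -
    from that have w: "w \<noteq> []" by (auto simp: words_def)
    have "linear_eval (scl W) single_letter (?g w)
        = (\<Sum>k=1..length w. \<Sum>ws\<in>cuts k w. single_letter (map (\<lambda>b. (word_degree b, f b)) ws))"
      by (simp add: sum linear_eval_fword[OF W])
    also have "\<dots> = (\<Sum>k\<in>{1}. \<Sum>ws\<in>cuts k w. single_letter (map (\<lambda>b. (word_degree b, f b)) ws))"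
      using w by (intro sum.mono_neutral_right)
        (auto simp: Suc_le_eq single_letter_def cuts_def intro!: sum.neutral)
    also have "\<dots> = f w"
      using cuts_one[OF w] by (simp add: single_letter_def)
    finally show ?thesis .
  qed
  then have "linear_eval (scl W) single_letter (lin_ext ?g x) = linear_eval (scl W) f x" if "x \<in> X" for x
    unfolding linear_eval_lin_ext[OF W] using that X
    by (intro linear_eval_cong) (auto simp: formal_space_def)
  then have "(\<lambda>x. linear_eval (scl W) single_letter (lin_ext ?g x)) ` X = linear_eval (scl W) f ` X"
    by (intro image_cong refl)
  then have "linear_eval (scl W) single_letter ` tensor_map W ?g X = linear_eval (scl W) f ` X"
    using image_linear_eval_tensor_map[OF W multilinear_single_letter[OF W] g] by (simp only:)
  then show ?thesis
    by (simp add: corestriction_def proj_eq coalg_morphism_def)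
qed

section \<open>Shuffle permutations and shuffles of lists\<close>

text \<open>When the letters of the two lists are disjoint, a shuffle is determined by its letters and remembers
  both lists as subsequences.  This description is symmetric under reversal and can be checked
  for the one-line notation of a permutation, unlike the recursive definition.\<close>

lemma shuffles_iff_filter:
  assumes "set us \<inter> set vs = {}"
  shows "zs \<in> shuffles us vs \<longleftrightarrow>
    set zs = set us \<union> set vs \<and> filter (\<lambda>x. x \<in> set us) zs = us \<and> filter (\<lambda>x. x \<notin> set us) zs = vs"
    (is "?L \<longleftrightarrow> ?R")
proof
  assume ?L
  with assms show ?R
    by (simp add: filter_shuffles_disjoint1 set_shuffles)
next
  assume ?R
  with partition_in_shuffles[of zs "\<lambda>x. x \<in> set us"] show ?L by simp
qed

lemma rev_image_shuffles:
  assumes "set us \<inter> set vs = {}"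
  shows "rev ` shuffles us vs = shuffles (rev us) (rev vs)"
proof -
  have "rev zs \<in> shuffles (rev us) (rev vs) \<longleftrightarrow> zs \<in> shuffles us vs" for zs
    using assms by (simp add: shuffles_iff_filter rev_filter[symmetric])
  then have "zs \<in> rev ` shuffles us vs \<longleftrightarrow> zs \<in> shuffles (rev us) (rev vs)" for zs
    by (subst rev_rev_ident[of zs, symmetric], subst inj_image_mem_iff[OF inj_on_rev])
      (metis rev_rev_ident)
  then show ?thesis by blast
qed

lemma map_inv_permutes:
  assumes "\<sigma> permutes {..<n}"
  shows "distinct (map (inv \<sigma>) [0..<n])" "set (map (inv \<sigma>) [0..<n]) = {..<n}"
  using permutes_inj_on[OF permutes_inv[OF assms]] permutes_image[OF permutes_inv[OF assms]]
  by (auto simp: distinct_map atLeast0LessThan)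

text \<open>The one-line notation of \<open>inv \<sigma>\<close> lists \<open>i\<close> at position \<open>\<sigma> i\<close>.  So the letters of an interval
  appear in increasing order precisely when \<open>\<sigma>\<close> is increasing on that interval.\<close>

lemma filter_map_inv_eq_upt_iff:
  assumes \<sigma>: "\<sigma> permutes {..<n}" and P: "\<And>j. j < n \<and> P j \<longleftrightarrow> j \<in> {l..<m}"
  shows "filter P (map (inv \<sigma>) [0..<n]) = [l..<m] \<longleftrightarrow> strict_mono_on {l..<m} \<sigma>"
proof
  let ?xs = "map (inv \<sigma>) [0..<n]"
  note inv = permutes_inverses[OF \<sigma>]
  have set: "set (filter P ?xs) = {l..<m}"
    unfolding set_filter map_inv_permutes(2)[OF \<sigma>] using P by blast
  assume eq: "filter P ?xs = [l..<m]"
  have sorted: "sorted (filter P ?xs)" unfolding eq by simp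
  show "strict_mono_on {l..<m} \<sigma>"
  proof (rule strict_mono_onI, rule ccontr)
    fix i j assume ij: "i \<in> {l..<m}" "j \<in> {l..<m}" "i < j" and "\<not> \<sigma> i < \<sigma> j"
    moreover have "\<sigma> i \<noteq> \<sigma> j" using ij(3) inv(2) by (metis less_irrefl)
    ultimately have less: "\<sigma> j < \<sigma> i" by simp
    have "i < n" "j < n" "P i" "P j" using ij(1,2) P by blast+
    then have lt: "\<sigma> i < n" "\<sigma> j < n" using permutes_in_image[OF \<sigma>] by auto
    have "sorted_wrt (\<lambda>x y. inv \<sigma> x \<le> inv \<sigma> y) (filter (P \<circ> inv \<sigma>) [0..<n])"
      using sorted by (simp add: filter_map sorted_map)
    moreover have "[0..<n] = [0..<\<sigma> i] @ [\<sigma> i..<n]"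
      using lt upt_add_eq_append[of 0 "\<sigma> i" "n - \<sigma> i"] by simp
    ultimately have "inv \<sigma> (\<sigma> j) \<le> inv \<sigma> (\<sigma> i)" 
      using less lt \<open>P i\<close> \<open>P j\<close>
      by (simp add: sorted_wrt_append inv) (metis inv(2) order_refl)
    with \<open>i < j\<close> inv show False by simp
  qed
next
  let ?xs = "map (inv \<sigma>) [0..<n]"
  note inv = permutes_inverses[OF \<sigma>]
  assume mono: "strict_mono_on {l..<m} \<sigma>"
  have set: "set (filter P ?xs) = {l..<m}"
    unfolding set_filter map_inv_permutes(2)[OF \<sigma>] using P by blast
  have "sorted_wrt (<) (filter (P \<circ> inv \<sigma>) [0..<n])"
    by (intro sorted_wrt_filter) simp
  then have "sorted_wrt (\<lambda>x y. inv \<sigma> x \<le> inv \<sigma> y) (filter (P \<circ> inv \<sigma>) [0..<n])"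
  proof (rule sorted_wrt_mono_rel[rotated])
    fix x y assume "x \<in> set (filter (P \<circ> inv \<sigma>) [0..<n])" "y \<in> set (filter (P \<circ> inv \<sigma>) [0..<n])" "x < y"
    then have "inv \<sigma> x < n \<and> P (inv \<sigma> x)" "inv \<sigma> y < n \<and> P (inv \<sigma> y)"
      using permutes_in_image[OF permutes_inv[OF \<sigma>]] by auto
    then have "inv \<sigma> x \<in> {l..<m}" "inv \<sigma> y \<in> {l..<m}"
      unfolding P .
    then have "inv \<sigma> y < inv \<sigma> x \<Longrightarrow> y < x"
      using strict_mono_onD[OF mono, of "inv \<sigma> y" "inv \<sigma> x"] by (simp add: inv)
    with \<open>x < y\<close> show "inv \<sigma> x \<le> inv \<sigma> y" by linarith
  qed
  then have "sorted (filter P ?xs)" by (simp add: filter_map sorted_map)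
  moreover have "distinct (filter P ?xs)" using map_inv_permutes(1)[OF \<sigma>] by (rule distinct_filter)
  ultimately show "filter P ?xs = [l..<m]"
    using set by (intro sorted_distinct_set_unique) (auto simp del: set_filter)
qed

lemma strict_mono_on_interval_iff_Suc:
  "strict_mono_on {l..<m} (\<sigma> :: nat \<Rightarrow> nat) \<longleftrightarrow> (\<forall>i. l \<le> i \<and> Suc i < m \<longrightarrow> \<sigma> i < \<sigma> (Suc i))"
proof
  assume *: "\<forall>i. l \<le> i \<and> Suc i < m \<longrightarrow> \<sigma> i < \<sigma> (Suc i)"
  show "strict_mono_on {l..<m} \<sigma>"
  proof (rule strict_mono_onI)
    fix i j assume "i \<in> {l..<m}" "j \<in> {l..<m}" "i < j"
    from \<open>i < j\<close> have "Suc i \<le> j" by simp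
    then have "j < m \<longrightarrow> \<sigma> i < \<sigma> j"
      by (induction j rule: dec_induct) (use * \<open>i \<in> _\<close> in \<open>auto intro: less_trans\<close>)
    with \<open>j \<in> _\<close> show "\<sigma> i < \<sigma> j" by simp
  qed
qed (auto simp: strict_mono_on_def)

text \<open>The condition at consecutive positions other than the cut says that \<open>\<sigma>\<close> is increasing on each
  of the two blocks, which is the description of shuffles by their subsequences.\<close>

lemma shuffle_perms_iff:
  assumes "p \<le> n"
  shows "\<sigma> \<in> shuffle_perms p n \<longleftrightarrow>
    \<sigma> permutes {..<n} \<and> map (inv \<sigma>) [0..<n] \<in> shuffles [0..<p] [p..<n]"
proof (cases "\<sigma> permutes {..<n}")
  case True
  have "\<sigma> \<in> shuffle_perms p n \<longleftrightarrow> strict_mono_on {0..<p} \<sigma> \<and> strict_mono_on {p..<n} \<sigma>"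
  proof -
    have "Suc i < n \<and> Suc i \<noteq> p \<longleftrightarrow> (0 \<le> i \<and> Suc i < p) \<or> (p \<le> i \<and> Suc i < n)" for i
      using assms by auto
    then show ?thesis
      using True unfolding shuffle_perms_def strict_mono_on_interval_iff_Suc by blast
  qed
  also have "\<dots> \<longleftrightarrow> filter (\<lambda>j. j \<in> set [0..<p]) (map (inv \<sigma>) [0..<n]) = [0..<p] \<and>
      filter (\<lambda>j. j \<notin> set [0..<p]) (map (inv \<sigma>) [0..<n]) = [p..<n]"
    using assms
    by (intro arg_cong2[where f = conj] filter_map_inv_eq_upt_iff[symmetric] True) auto
  also have "\<dots> \<longleftrightarrow> map (inv \<sigma>) [0..<n] \<in> shuffles [0..<p] [p..<n]"
    using assms map_inv_permutes(2)[OF True]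
    by (subst shuffles_iff_filter) (auto simp: lessThan_atLeast0)
  finally show ?thesis using True by simp
qed (simp add: shuffle_perms_def)

text \<open>Trading permutations for lists gives access to the recursion for shuffles, on which the proof
  of Ree's identity rests.\<close>

lemma sum_shuffle_perms:
  assumes "p \<le> n"
  shows "(\<Sum>\<sigma>\<in>shuffle_perms p n. F (map (inv \<sigma>) [0..<n])) = (\<Sum>z\<in>shuffles [0..<p] [p..<n]. F z)"
proof (rule sum.reindex_bij_betw)
  show "bij_betw (\<lambda>\<sigma>. map (inv \<sigma>) [0..<n]) (shuffle_perms p n) (shuffles [0..<p] [p..<n])"
  proof (intro bij_betwI')
    fix \<sigma> \<tau> assume "\<sigma> \<in> shuffle_perms p n" "\<tau> \<in> shuffle_perms p n"
    then have perm: "\<sigma> permutes {..<n}" "\<tau> permutes {..<n}"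
      by (simp_all add: shuffle_perms_def)
    show "map (inv \<sigma>) [0..<n] = map (inv \<tau>) [0..<n] \<longleftrightarrow> \<sigma> = \<tau>"
    proof
      assume eq: "map (inv \<sigma>) [0..<n] = map (inv \<tau>) [0..<n]"
      have "inv \<sigma> = inv \<tau>"
      proof
        fix x show "inv \<sigma> x = inv \<tau> x"
          using eq perm[THEN permutes_inv] by (cases "x < n") (auto simp: permutes_def)
      qed
      then show "\<sigma> = \<tau>" by (metis perm permutes_inv_inv)
    qed simp
  next
    fix \<sigma> assume "\<sigma> \<in> shuffle_perms p n"
    then show "map (inv \<sigma>) [0..<n] \<in> shuffles [0..<p] [p..<n]"
      using shuffle_perms_iff[OF assms] by blast
  next
    fix z assume z: "z \<in> shuffles [0..<p] [p..<n]"
    then have len: "length z = n" using length_shuffles[OF z] assms by simp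
    have dist: "distinct z" using distinct_disjoint_shuffles[OF _ _ _ z] by simp
    have "set z = {0..<p} \<union> {p..<n}" using set_shuffles[OF z] by simp
    then have set: "set z = {..<n}"
      using ivl_disj_un_two(3)[of 0 p n] assms by (simp only: zero_le atLeast0LessThan)
    define \<rho> where "\<rho> = (\<lambda>i. if i < n then z ! i else i)"
    have "bij_betw ((!) z) {..<n} {..<n}"
      using dist by (rule bij_betw_nth) (simp_all only: len set)
    moreover have "bij_betw \<rho> {..<n} {..<n} \<longleftrightarrow> bij_betw ((!) z) {..<n} {..<n}"
      by (rule bij_betw_cong) (simp add: \<rho>_def)
    ultimately have "bij_betw \<rho> {..<n} {..<n}" by simp
    then have \<rho>: "\<rho> permutes {..<n}"
      by (rule bij_imp_permutes) (simp add: \<rho>_def)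
    have "map \<rho> [0..<n] = z" by (rule nth_equalityI) (auto simp: len \<rho>_def)
    then have "map (inv (inv \<rho>)) [0..<n] = z" using permutes_inv_inv[OF \<rho>] by simp
    moreover from this have "inv \<rho> \<in> shuffle_perms p n"
      using shuffle_perms_iff[OF assms] z permutes_inv[OF \<rho>] by (simp only: simp_thms)
    ultimately show "\<exists>\<sigma>\<in>shuffle_perms p n. z = map (inv \<sigma>) [0..<n]"
      by (intro bexI[of _ "inv \<rho>"]) (simp_all only:)
  qed
qed



section \<open>Shuffle products of words\<close>

text \<open>Shuffling permutes letters, so it preserves length and letters.  This coarse invariant of a word
  decides whether it lies in \<open>words V\<close> and whether all its letters are one-forms.\<close>

definition rearrangements :: "nat \<Rightarrow> 'b set \<Rightarrow> 'b list set" where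
  "rearrangements n A = {z. length z = n \<and> set z = A}"

lemma image_nth_upt: "(!) w ` {0..<length w} = set w"
  by (metis map_nth set_map set_upt)

lemma shuffle_words_supported:
  "shuffle_words u v \<in> supported_on (rearrangements (length u + length v) (set u \<union> set v))"
proof -
  let ?w = "u @ v"
  have "map (\<lambda>i. ?w ! (inv \<sigma> i)) [0..<length ?w] \<in> rearrangements (length u + length v) (set u \<union> set v)"
    if "\<sigma> \<in> shuffle_perms (length u) (length ?w)" for \<sigma>
  proof -
    have "\<sigma> permutes {..<length ?w}" using that by (simp add: shuffle_perms_def)
    then have "inv \<sigma> ` {0..<length ?w} = {0..<length ?w}"
      unfolding atLeast0LessThan by (intro permutes_image permutes_inv)
    then have "set (map (\<lambda>i. ?w ! (inv \<sigma> i)) [0..<length ?w]) = (!) ?w ` {0..<length ?w}"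
      unfolding set_map set_upt by (metis image_image)
    also have "\<dots> = set ?w" by (rule image_nth_upt)
    finally show ?thesis by (simp add: rearrangements_def)
  qed
  then show ?thesis
    unfolding shuffle_words_def Let_def
    by (intro supported_on_sum supported_on_fscale supported_on_fword)
qed

lemma shuffle_fword_supported:
  assumes "x \<in> supported_on (rearrangements n A)"
  shows "shuffle x (fword v) \<in> supported_on (rearrangements (n + length v) (A \<union> set v))"
  unfolding shuffle_def lin_ext_fword
proof (rule supported_on_lin_ext[OF assms])
  fix u assume "u \<in> rearrangements n A"
  then show "shuffle_words u v \<in> supported_on (rearrangements (n + length v) (A \<union> set v))"
    using shuffle_words_supported[of u v] by (simp add: rearrangements_def)
qed

lemma shuffle_list_supported:
  fixes ws :: "'b word list"
  assumes "ws \<noteq> []"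
  shows "(shuffle_list ws :: ('k::field, 'b) formal)
    \<in> supported_on (rearrangements (length (concat ws)) (set (concat ws)))"
proof -
  have "foldl shuffle x (map fword vs)
      \<in> supported_on (rearrangements (n + length (concat vs)) (A \<union> set (concat vs)))"
    if "x \<in> supported_on (rearrangements n A)" for x :: "('k::field, 'b) formal" and n A vs
    using that
  proof (induction vs arbitrary: x n A)
    case (Cons v vs)
    from Cons.IH[OF shuffle_fword_supported[OF Cons.prems]] show ?case
      by (simp add: Un_assoc add.assoc)
  qed simp
  moreover obtain u vs where "ws = u # vs" using assms by (cases ws) auto
  moreover have "(fword u :: ('k, 'b) formal) \<in> supported_on (rearrangements (length u) (set u))"
    by (rule supported_on_fword) (simp add: rearrangements_def)
  ultimately show ?thesis by (simp add: shuffle_list_def)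
qed

lemma eulerian_adj_word_supported:
  "(eulerian_adj_word w :: ('k::field_char_0, 'v) formal) \<in> supported_on (rearrangements (length w) (set w))"
proof -
  have "(shuffle_list ws :: ('k::field_char_0, 'v) formal) \<in> supported_on (rearrangements (length w) (set w))"
    if "ws \<in> cuts k w" "k \<in> {2..length w}" for k ws
    using that shuffle_list_supported[of ws, where 'k = 'k] by (cases "ws = []") (auto simp: cuts_def)
  then show ?thesis
    unfolding eulerian_adj_word_def
    by (intro supported_on_add supported_on_sum supported_on_fscale supported_on_fword)
      (auto simp: rearrangements_def)
qed

lemma module_times: "module ((*) :: 'k::field \<Rightarrow> 'k \<Rightarrow> 'k)"
  by unfold_locales (simp_all add: algebra_simps)

lemma koszul_sign_degree_zero:
  assumes "\<And>x. x \<in> set w \<Longrightarrow> fst x = 0"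
  shows "koszul_sign \<sigma> w = 1"
  unfolding koszul_sign_def by (rule prod.neutral) (auto simp: assms)

text \<open>The Koszul signs are trivial because letters of degree zero commute without signs.\<close>

lemma linear_eval_shuffle_words_degree_zero:
  assumes s: "module s" and deg: "\<And>x. x \<in> set (u @ v) \<Longrightarrow> fst x = 0"
  shows "linear_eval s f (shuffle_words u v)
    = (\<Sum>z\<in>shuffles [0..<length u] [length u..<length (u @ v)]. f (map ((!) (u @ v)) z))"
proof -
  interpret s: module s by fact
  interpret module_hom fscale s "linear_eval s f" by (rule module_hom_linear_eval[OF s])
  let ?n = "length (u @ v)"
  have "linear_eval s f (shuffle_words u v)
      = (\<Sum>\<sigma>\<in>shuffle_perms (length u) ?n. f (map ((!) (u @ v)) (map (inv \<sigma>) [0..<?n])))"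
    unfolding shuffle_words_def Let_def sum scale linear_eval_fword[OF s]
    by (simp only: koszul_sign_degree_zero[OF deg] s.scale_one map_map o_def)
  also have "\<dots> = (\<Sum>z\<in>shuffles [0..<length u] [length u..<?n]. f (map ((!) (u @ v)) z))"
    by (rule sum_shuffle_perms) simp
  finally show ?thesis .
qed

text \<open>A linear functional that is multiplicative for the shuffle product of words is multiplicative
  for iterated shuffle products.  The set \<open>D\<close> accounts for functionals that are multiplicative
  only on some words, such as those made of one-forms.\<close>

lemma linear_eval_shuffle_list:
  fixes f :: "'v word \<Rightarrow> 'k::field"
  assumes mult: "\<And>u v. u \<in> D \<Longrightarrow> v \<in> D \<Longrightarrow>
      linear_eval (*) f (shuffle_words u v) = f u * f v"
    and closed: "\<And>u v. u \<in> D \<Longrightarrow> v \<in> D \<Longrightarrow> shuffle_words u v \<in> (supported_on D :: ('k, 'v) formal set)"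
    and ws: "ws \<noteq> []" "set ws \<subseteq> D"
  shows "linear_eval (*) f (shuffle_list ws) = prod_list (map f ws)"
proof -
  have step: "linear_eval (*) f (shuffle x (fword v)) = linear_eval (*) f x * f v"
    if "x \<in> supported_on D" "v \<in> D" for x v
  proof -
    have "linear_eval (*) f (shuffle x (fword v)) = linear_eval (*) (\<lambda>u. f u * f v) x"
      unfolding shuffle_def lin_ext_fword linear_eval_lin_ext[OF module_times]
      by (rule linear_eval_cong) (use that mult in \<open>auto simp: supported_on_def\<close>)
    then show ?thesis by (simp add: linear_eval_def sum_distrib_right mult.assoc)
  qed
  have "linear_eval (*) f (foldl shuffle x (map fword vs)) = linear_eval (*) f x * prod_list (map f vs)"
    if "x \<in> supported_on D" "set vs \<subseteq> D" for x vs
    using that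
  proof (induction vs arbitrary: x)
    case (Cons v vs)
    have "shuffle x (fword v) \<in> supported_on D"
      unfolding shuffle_def lin_ext_fword
      by (rule supported_on_lin_ext[OF Cons.prems(1)]) (use Cons.prems closed in auto)
    with Cons show ?case by (simp add: step mult.assoc)
  qed simp
  moreover obtain u vs where "ws = u # vs" using ws by (cases ws) auto
  ultimately show ?thesis
    using ws supported_on_fword[of u D, where 'b = 'k]
    by (simp add: shuffle_list_def linear_eval_fword[OF module_times])
qed

section \<open>Iterated integrals over a Rota-Baxter operator\<close>

lemma word_degree_zero: "(\<forall>(d, v) \<in> set w. d = 0) \<Longrightarrow> word_degree w = 0"
  by (induction w) (auto simp: word_degree_def)

text \<open>\<open>J f\<close> stands for the primitive of \<open>f\<close> that vanishes at 0.  Integration by parts makes it a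
  Rota-Baxter operator of weight zero on the algebra \<open>A\<close>.  The algebra \<open>A\<close> may be larger than the
  space of coefficient functions of forms: smooth functions on \<open>[0,1]\<close> are extended by zero, so they
  do not contain the constant function 1 at which the iteration starts, whereas continuity on
  \<open>[0,1]\<close> is insensitive to the values elsewhere.\<close>

locale iterated_integrals =
  fixes M :: "('k::field_char_0, 'f::comm_ring_1) functions01"
    and A :: "'f set"
    and J :: "'f \<Rightarrow> 'f"
  assumes module_smul: "module (smul M)"
    and smul_mult: "smul M c f * g = smul M c (f * g)"
    and eval_add: "eval_fn M (f + g) x = eval_fn M f x + eval_fn M g x"
    and eval_mult: "eval_fn M (f * g) x = eval_fn M f x * eval_fn M g x"
    and eval_smul: "eval_fn M (smul M c f) x = c * eval_fn M f x"
    and unit_fn_nonzero: "unit_fn M \<noteq> 0"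
    and fns_zero: "0 \<in> fns M"
    and fns_add: "a \<in> fns M \<Longrightarrow> b \<in> fns M \<Longrightarrow> a + b \<in> fns M"
    and fns_smul: "a \<in> fns M \<Longrightarrow> smul M c a \<in> fns M"
    and fns_subset: "fns M \<subseteq> A"
    and one_mem: "1 \<in> A"
    and add_mem: "f \<in> A \<Longrightarrow> g \<in> A \<Longrightarrow> f + g \<in> A"
    and mult_mem: "f \<in> A \<Longrightarrow> g \<in> A \<Longrightarrow> f * g \<in> A"
    and J_mem: "f \<in> A \<Longrightarrow> J f \<in> A"
    and J_add: "f \<in> A \<Longrightarrow> g \<in> A \<Longrightarrow> J (f + g) = J f + J g"
    and J_smul: "f \<in> A \<Longrightarrow> J (smul M c f) = smul M c (J f)"
    and Rota_Baxter: "f \<in> A \<Longrightarrow> g \<in> A \<Longrightarrow> J f * J g = J (f * J g) + J (J f * g)"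
    and int01_eq: "a \<in> fns M \<Longrightarrow> int01 M a = eval_fn M (J a) 1"
    and simplex_int_eq: "set as \<subseteq> fns M \<Longrightarrow>
      simplex_int M as = eval_fn M (foldl (\<lambda>P a. J (a * P)) 1 as) 1"
begin

sublocale smul: module "smul M" by (rule module_smul)

lemma module_form_scale: "module (form_scale M)"
  by unfold_locales
    (simp_all add: form_scale_def smul.scale_right_distrib smul.scale_left_distrib)

sublocale form: module "form_scale M" by (rule module_form_scale)

lemma zero_mem: "0 \<in> A" using fns_zero fns_subset by blast

lemma J_zero: "J 0 = 0"
  using J_add[OF zero_mem zero_mem] by simp

lemma eval_zero: "eval_fn M 0 x = 0"
  using eval_add[of 0 0 x] by simp

lemma eval_sum: "eval_fn M (\<Sum>i\<in>I. f i) x = (\<Sum>i\<in>I. eval_fn M (f i) x)"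
  by (induction I rule: infinite_finite_induct) (simp_all add: eval_zero eval_add)

lemma sum_mem: "(\<And>i. i \<in> I \<Longrightarrow> f i \<in> A) \<Longrightarrow> (\<Sum>i\<in>I. f i) \<in> A"
  by (induction I rule: infinite_finite_induct) (simp_all add: zero_mem add_mem)

lemma J_sum: "(\<And>i. i \<in> I \<Longrightarrow> f i \<in> A) \<Longrightarrow> J (\<Sum>i\<in>I. f i) = (\<Sum>i\<in>I. J (f i))"
  by (induction I rule: infinite_finite_induct) (simp_all add: J_zero J_add sum_mem)

text \<open>The nested integral in which the last function of the list is integrated outermost, matching the
  simplex \<open>t\<^sub>1 \<le> \<dots> \<le> t\<^sub>n\<close>.\<close>

definition iter :: "'f list \<Rightarrow> 'f" where
  "iter as = foldl (\<lambda>P a. J (a * P)) 1 as"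

lemma iter_Nil [simp]: "iter [] = 1"
  and iter_snoc [simp]: "iter (as @ [a]) = J (a * iter as)"
  by (simp_all add: iter_def)

lemma iter_mem: "set as \<subseteq> A \<Longrightarrow> iter as \<in> A"
  by (induction as rule: rev_induct) (simp_all add: one_mem J_mem mult_mem)

lemma iter_add:
  assumes "set as \<subseteq> A" "a \<in> A" "b \<in> A" "set bs \<subseteq> A"
  shows "iter (as @ [a + b] @ bs) = iter (as @ [a] @ bs) + iter (as @ [b] @ bs)"
  using assms(4)
proof (induction bs rule: rev_induct)
  case Nil
  show ?case
    using assms by (simp add: distrib_right J_add mult_mem iter_mem)
next
  case (snoc c bs)
  have mem: "iter (as @ [a] @ bs) \<in> A" "iter (as @ [b] @ bs) \<in> A"
    by (rule iter_mem, use assms snoc in auto)+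
  have "iter (as @ [a + b] @ bs @ [c]) = J (c * iter (as @ [a + b] @ bs))"
    by (metis append_assoc iter_snoc)
  also have "\<dots> = J (c * iter (as @ [a] @ bs) + c * iter (as @ [b] @ bs))"
    using snoc by (simp add: distrib_left)
  also have "\<dots> = J (c * iter (as @ [a] @ bs)) + J (c * iter (as @ [b] @ bs))"
    using mem snoc.prems by (intro J_add mult_mem) auto
  also have "\<dots> = iter (as @ [a] @ bs @ [c]) + iter (as @ [b] @ bs @ [c])"
    by (metis append_assoc iter_snoc)
  finally show ?case .
qed

lemma iter_smul:
  assumes "set as \<subseteq> A" "a \<in> A" "set bs \<subseteq> A"
  shows "iter (as @ [smul M c a] @ bs) = smul M c (iter (as @ [a] @ bs))"
  using assms(3)
proof (induction bs rule: rev_induct)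
  case Nil
  show ?case
    using assms by (simp add: smul_mult J_smul mult_mem iter_mem)
next
  case (snoc b bs)
  have mem: "iter (as @ [a] @ bs) \<in> A"
    by (rule iter_mem, use assms snoc in auto)
  have "iter (as @ [smul M c a] @ bs @ [b]) = J (b * iter (as @ [smul M c a] @ bs))"
    by (metis append_assoc iter_snoc)
  also have "\<dots> = J (smul M c (b * iter (as @ [a] @ bs)))"
    using snoc smul_mult by (simp add: mult.commute[of b])
  also have "\<dots> = smul M c (J (b * iter (as @ [a] @ bs)))"
    using mem snoc.prems by (intro J_smul mult_mem) auto
  also have "\<dots> = smul M c (iter (as @ [a] @ bs @ [b]))"
    by (metis append_assoc iter_snoc)
  finally show ?case .
qed

text \<open>Ree's identity.  A product of two nested integrals \<open>J (a * P) * J (b * Q)\<close> is by the Rota-Baxter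
  equation the sum of \<open>J (a * (P * J (b * Q)))\<close> and \<open>J (b * (J (a * P) * Q))\<close>: either \<open>a\<close> or \<open>b\<close> is
  outermost.  Shuffles of two lists split in the same way by their first letter.  Outermost
  factors come last in \<open>iter\<close>, which is why the lists are reversed.\<close>

lemma sum_iter_rev_shuffles:
  assumes "set us \<inter> set vs = {}" "f ` (set us \<union> set vs) \<subseteq> A"
  shows "(\<Sum>z\<in>shuffles us vs. iter (rev (map f z)))
    = iter (rev (map f us)) * iter (rev (map f vs))"
  using assms
proof (induction us vs rule: shuffles.induct)
  case (3 x xs y ys)
  let ?R = "\<lambda>zs. iter (rev (map f zs))"
  have R_mem: "?R zs \<in> A" if "set zs \<subseteq> set (x # xs) \<union> set (y # ys)" for zs
    by (rule iter_mem) (use that 3(4) in auto)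
  have fmem: "f x \<in> A" "f y \<in> A" using 3(4) by auto
  have head: "(\<Sum>z\<in>(#) a ` S. ?R z) = J (f a * (\<Sum>z\<in>S. ?R z))"
    if "f a \<in> A" "\<And>z. z \<in> S \<Longrightarrow> ?R z \<in> A" for a S
    by (simp add: sum.reindex sum_distrib_left J_sum mult_mem that)
  have "(\<Sum>z\<in>shuffles (x # xs) (y # ys). ?R z)
      = (\<Sum>z\<in>(#) x ` shuffles xs (y # ys). ?R z) + (\<Sum>z\<in>(#) y ` shuffles (x # xs) ys. ?R z)"
    unfolding shuffles.simps using 3(3) by (intro sum.union_disjoint) auto
  also have "(\<Sum>z\<in>(#) x ` shuffles xs (y # ys). ?R z) = J (f x * (?R xs * ?R (y # ys)))"
    using 3 fmem by (subst head) (auto intro!: R_mem dest!: set_shuffles)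
  also have "(\<Sum>z\<in>(#) y ` shuffles (x # xs) ys. ?R z) = J (f y * (?R (x # xs) * ?R ys))"
    using 3 fmem by (subst head) (auto intro!: R_mem dest!: set_shuffles)
  also have "J (f x * (?R xs * ?R (y # ys))) + J (f y * (?R (x # xs) * ?R ys))
      = ?R (x # xs) * ?R (y # ys)"
  proof -
    have "f x * ?R xs \<in> A" "f y * ?R ys \<in> A"
      by (intro mult_mem fmem R_mem; auto)+
    from Rota_Baxter[OF this] show ?thesis by (simp add: ac_simps)
  qed
  finally show ?case .
qed simp_all

lemma sum_iter_shuffles:
  assumes "set us \<inter> set vs = {}" "f ` (set us \<union> set vs) \<subseteq> A"
  shows "(\<Sum>z\<in>shuffles us vs. iter (map f z)) = iter (map f us) * iter (map f vs)"
proof -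
  have "(\<Sum>z\<in>shuffles us vs. iter (map f z)) = (\<Sum>z\<in>rev ` shuffles us vs. iter (rev (map f z)))"
    by (subst sum.reindex) (auto simp: rev_map)
  also have "\<dots> = (\<Sum>z\<in>shuffles (rev us) (rev vs). iter (rev (map f z)))"
    by (simp add: rev_image_shuffles[OF assms(1)])
  also have "\<dots> = iter (map f us) * iter (map f vs)"
    using assms by (subst sum_iter_rev_shuffles) (simp_all add: rev_map)
  finally show ?thesis .
qed

section \<open>Iterated integrals along shuffle products of words\<close>

text \<open>Since the suspension shifts degrees, one-forms have degree 0.\<close>

definition one_form_words :: "('f \<times> 'f) word set" where
  "one_form_words = {w. w \<noteq> [] \<and> set w \<subseteq> {0} \<times> ({0} \<times> fns M)}"

definition word_int :: "('f \<times> 'f) word \<Rightarrow> 'k" where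
  "word_int w = simplex_int M (map (\<lambda>(d, \<omega>). snd \<omega>) w)"

lemma word_int_eq_iter:
  assumes "w \<in> one_form_words"
  shows "word_int w = eval_fn M (iter (map (\<lambda>(d, \<omega>). snd \<omega>) w)) 1"
  unfolding word_int_def iter_def
  by (rule simplex_int_eq) (use assms in \<open>auto simp: one_form_words_def\<close>)

lemma shuffle_words_one_form:
  assumes "u \<in> one_form_words" "v \<in> one_form_words"
  shows "(shuffle_words u v :: ('k, 'f \<times> 'f) formal) \<in> supported_on one_form_words"
proof -
  have "rearrangements (length u + length v) (set u \<union> set v) \<subseteq> one_form_words"
    using assms by (auto simp: rearrangements_def one_form_words_def)
  with shuffle_words_supported[of u v, where ?'b = 'k] show ?thesis
    unfolding supported_on_def by blast
qed

text \<open>Letters of a word may repeat, while shuffles of lists are sets.  The identity is therefore applied to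
  the positions of the letters, which are distinct.\<close>

lemma word_int_shuffle_words:
  assumes "u \<in> one_form_words" "v \<in> one_form_words"
  shows "linear_eval (*) word_int (shuffle_words u v) = word_int u * word_int v"
proof -
  let ?w = "u @ v" and ?a = "\<lambda>x :: int \<times> 'f \<times> 'f. snd (snd x)"
  let ?f = "\<lambda>i. ?a (?w ! i)" and ?p = "length u" and ?n = "length (u @ v)"
  have w: "?w \<in> one_form_words" using assms by (auto simp: one_form_words_def)
  have snd_eq: "(\<lambda>(d, \<omega>). snd \<omega>) = ?a" by auto
  have "linear_eval (*) word_int (shuffle_words u v)
      = (\<Sum>z\<in>shuffles [0..<?p] [?p..<?n]. word_int (map ((!) ?w) z))"
    by (rule linear_eval_shuffle_words_degree_zero[OF module_times])
      (use w in \<open>auto simp: one_form_words_def\<close>)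
  also have "\<dots> = (\<Sum>z\<in>shuffles [0..<?p] [?p..<?n]. eval_fn M (iter (map ?f z)) 1)"
  proof (rule sum.cong[OF refl])
    fix z assume z: "z \<in> shuffles [0..<?p] [?p..<?n]"
    have "set z = {0..<?p} \<union> {?p..<?n}" using set_shuffles[OF z] by simp
    also have "\<dots> = {0..<?n}" by (rule ivl_disj_un_two(3)) simp_all
    finally have "set (map ((!) ?w) z) = set ?w"
      by (simp only: set_map image_nth_upt)
    moreover have "z \<noteq> []" using z w by (auto simp: one_form_words_def)
    ultimately have "map ((!) ?w) z \<in> one_form_words"
      using w by (simp add: one_form_words_def)
    from word_int_eq_iter[OF this]
    show "word_int (map ((!) ?w) z) = eval_fn M (iter (map ?f z)) 1"
      unfolding snd_eq map_map o_def .
  qed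
  also have "\<dots> = eval_fn M (\<Sum>z\<in>shuffles [0..<?p] [?p..<?n]. iter (map ?f z)) 1"
    by (simp add: eval_sum)
  also have "(\<Sum>z\<in>shuffles [0..<?p] [?p..<?n]. iter (map ?f z))
      = iter (map ?f [0..<?p]) * iter (map ?f [?p..<?n])"
  proof (rule sum_iter_shuffles)
    have "set (map ?f [0..<?n]) \<subseteq> A"
    proof -
      have "map ?f [0..<?n] = map ?a ?w" by (rule nth_equalityI) (simp_all del: map_append)
      then show ?thesis using w fns_subset by (auto simp: one_form_words_def)
    qed
    then show "?f ` (set [0..<?p] \<union> set [?p..<?n]) \<subseteq> A" by auto
  qed simp
  also have "map ?f [0..<?p] = map ?a u" by (rule nth_equalityI) (auto simp: nth_append)
  also have "map ?f [?p..<?n] = map ?a v" by (rule nth_equalityI) (auto simp: nth_append)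
  finally show ?thesis
    using assms by (simp only: eval_mult word_int_eq_iter snd_eq)
qed

lemma word_int_shuffle_list:
  assumes "ws \<noteq> []" "set ws \<subseteq> one_form_words"
  shows "linear_eval (*) word_int (shuffle_list ws) = prod_list (map word_int ws)"
  using word_int_shuffle_words shuffle_words_one_form assms by (rule linear_eval_shuffle_list)

section \<open>Whitney forms\<close>

lemma whitney0_zero [simp]: "whitney0 M 0 0 = 0"
  by (simp add: whitney0_def zero_prod_def)

lemma whitney1_zero [simp]: "whitney1 M 0 = 0"
  by (simp add: whitney1_def zero_prod_def)

lemma whitney0_add: "whitney0 M (a + a') (b + b') = whitney0 M a b + whitney0 M a' b'"
  by (simp add: whitney0_def smul.scale_left_distrib)

lemma whitney1_add: "whitney1 M (c + c') = whitney1 M c + whitney1 M c'"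
  by (simp add: whitney1_def smul.scale_left_distrib)

lemma form_scale_whitney0: "form_scale M c (whitney0 M a b) = whitney0 M (c * a) (c * b)"
  by (simp add: whitney0_def form_scale_def smul.scale_right_distrib)

lemma form_scale_whitney1: "form_scale M c (whitney1 M c') = whitney1 M (c * c')"
  by (simp add: whitney1_def form_scale_def)

lemma whitney1_sum: "whitney1 M (\<Sum>i\<in>I. f i) = (\<Sum>i\<in>I. whitney1 M (f i))"
  by (induction I rule: infinite_finite_induct) (simp_all add: whitney1_add)

lemma whitney1_inject: "whitney1 M c = whitney1 M c' \<longleftrightarrow> c = c'"
proof
  assume "whitney1 M c = whitney1 M c'"
  then have "smul M (c - c') (unit_fn M) = 0"
    by (simp add: whitney1_def smul.scale_left_diff_distrib)
  then have "smul M (inverse (c - c')) (smul M (c - c') (unit_fn M)) = 0"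
    by (simp only: smul.scale_zero_right)
  then have "smul M (inverse (c - c') * (c - c')) (unit_fn M) = 0"
    by (simp only: smul.scale_scale)
  with unit_fn_nonzero show "c = c'" by (cases "c = c'") auto
qed simp

text \<open>The coordinate of a one-form \<open>c dt\<close> that occurs in \<open>log_taylor\<close>.\<close>

definition whitney1_coeff :: "'f \<times> 'f \<Rightarrow> 'k" where
  "whitney1_coeff \<omega> = (THE c. \<omega> = whitney1 M c)"

lemma whitney1_coeff [simp]: "whitney1_coeff (whitney1 M c) = c"
  by (simp add: whitney1_coeff_def whitney1_inject)

lemma scl_susp [simp]: "scl (susp (Whitney M)) = form_scale M" "scl (susp (Omega M)) = form_scale M"
  by (simp_all add: susp_def Whitney_def Omega_def)

lemma piece_susp_Omega:
  "piece (susp (Omega M)) d = (if d = -1 then {(f, 0) | f. f \<in> fns M}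
     else if d = 0 then {(0, a) | a. a \<in> fns M} else {0})"
  by (simp add: susp_def Omega_def eq_neg_iff_add_eq_0)

lemma piece_susp_Whitney:
  "piece (susp (Whitney M)) d = (if d = -1 then {whitney0 M a b | a b. True}
     else if d = 0 then {whitney1 M c | c. True} else {0})"
  by (simp add: susp_def Whitney_def eq_neg_iff_add_eq_0)

lemma zero_mem_piece_susp_Whitney: "0 \<in> piece (susp (Whitney M)) d"
  by (auto simp: piece_susp_Whitney) (metis whitney1_zero, metis whitney0_zero)

section \<open>Multilinearity of the Taylor coefficients\<close>

lemma int01_zero: "int01 M 0 = 0"
  by (simp add: int01_eq fns_zero J_zero eval_zero)

lemma int01_add: "a \<in> fns M \<Longrightarrow> b \<in> fns M \<Longrightarrow> int01 M (a + b) = int01 M a + int01 M b"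
  using fns_subset by (simp add: int01_eq fns_add J_add subset_iff eval_add)

lemma int01_smul: "a \<in> fns M \<Longrightarrow> int01 M (smul M c a) = c * int01 M a"
  using fns_subset by (simp add: int01_eq fns_smul J_smul subset_iff eval_smul)

lemma whitney_proj_add:
  assumes "snd \<omega> \<in> fns M" "snd \<omega>' \<in> fns M"
  shows "whitney_proj M (\<omega> + \<omega>') = whitney_proj M \<omega> + whitney_proj M \<omega>'"
  using assms by (simp add: whitney_proj_def eval_add int01_add whitney0_add whitney1_add)

lemma snd_form_scale: "snd (form_scale M c \<omega>) = smul M c (snd \<omega>)"
  by (simp add: form_scale_def)

lemma whitney_proj_form_scale:
  assumes "snd \<omega> \<in> fns M"
  shows "whitney_proj M (form_scale M c \<omega>) = form_scale M c (whitney_proj M \<omega>)"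
proof -
  have "fst (form_scale M c \<omega>) = smul M c (fst \<omega>)"
    by (simp add: form_scale_def)
  then show ?thesis
    using assms by (simp add: snd_form_scale whitney_proj_def eval_smul int01_smul form.scale_right_distrib
        form_scale_whitney0 form_scale_whitney1)
qed

lemma snd_mem_fns: "\<omega> \<in> piece (susp (Omega M)) d \<Longrightarrow> snd \<omega> \<in> fns M"
  by (auto simp: piece_susp_Omega fns_zero split: if_splits)

lemma one_form_words_iff:
  assumes "w \<in> words (susp (Omega M))"
  shows "w \<in> one_form_words \<longleftrightarrow> (\<forall>(d, \<omega>) \<in> set w. d = 0)"
  using assms by (fastforce simp: words_def one_form_words_def piece_susp_Omega)

lemma lambda_taylor_one_forms:
  assumes "w \<in> one_form_words"
  shows "lambda_taylor M w = whitney1 M (word_int w)"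
proof (cases "length w = 1")
  case True
  then obtain a where w: "w = [(0, (0, a))]" "a \<in> fns M"
    using assms by (auto simp: length_Suc_conv one_form_words_def)
  then show ?thesis
    using word_int_eq_iter[OF assms] iter_snoc[of "[]" a]
    by (simp add: lambda_taylor_def whitney_proj_def eval_zero int01_eq)
next
  case False
  with assms show ?thesis
    by (auto simp: lambda_taylor_def word_int_def one_form_words_def)
qed

lemma lambda_taylor_zero:
  "length w \<noteq> 1 \<Longrightarrow> \<not> (\<forall>(d, \<omega>) \<in> set w. d = 0) \<Longrightarrow> lambda_taylor M w = 0"
  unfolding lambda_taylor_def by (simp only: if_False)

lemma word_int_add:
  assumes "a @ [(0, \<omega>)] @ b \<in> one_form_words" "a @ [(0, \<omega>')] @ b \<in> one_form_words"
  shows "word_int (a @ [(0, \<omega> + \<omega>')] @ b) = word_int (a @ [(0, \<omega>)] @ b) + word_int (a @ [(0, \<omega>')] @ b)"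
proof -
  have "a @ [(0, \<omega> + \<omega>')] @ b \<in> one_form_words"
    using assms by (auto simp: one_form_words_def fns_add)
  moreover have "set (map (\<lambda>(d, \<omega>). snd \<omega>) a) \<subseteq> A" "snd \<omega> \<in> A" "snd \<omega>' \<in> A"
      "set (map (\<lambda>(d, \<omega>). snd \<omega>) b) \<subseteq> A"
    using assms fns_subset by (auto simp: one_form_words_def)
  ultimately show ?thesis
    using assms
    by (simp only: word_int_eq_iter map_append list.map prod.case snd_add iter_add eval_add)
qed

lemma word_int_scale:
  assumes "a @ [(0, \<omega>)] @ b \<in> one_form_words"
  shows "word_int (a @ [(0, form_scale M c \<omega>)] @ b) = c * word_int (a @ [(0, \<omega>)] @ b)"
proof -
  have "a @ [(0, form_scale M c \<omega>)] @ b \<in> one_form_words"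
    using assms by (auto simp: one_form_words_def fns_smul form_scale_def)
  moreover have "set (map (\<lambda>(d, \<omega>). snd \<omega>) a) \<subseteq> A" "snd \<omega> \<in> A" "set (map (\<lambda>(d, \<omega>). snd \<omega>) b) \<subseteq> A"
    using assms fns_subset by (auto simp: one_form_words_def)
  ultimately show ?thesis
    using assms
    by (simp only: word_int_eq_iter map_append list.map prod.case snd_form_scale iter_smul eval_smul)
qed

lemma words_update:
  assumes "a @ [(d, v)] @ b \<in> words V" "v' \<in> piece V d"
  shows "a @ [(d, v')] @ b \<in> words V"
  using assms by (auto simp: words_def)

text \<open>Replacing a letter by another one of the same degree does not change which clause of the
  definition applies, and each clause is linear in the letter.\<close>

lemma multilinear_lambda_taylor:
  "multilinear_on (susp (Omega M)) (form_scale M) (lambda_taylor M)"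
  unfolding multilinear_on_def scl_susp
proof (intro conjI allI impI)
  fix a d v v' b
  assume w: "a @ [(d, v)] @ b \<in> words (susp (Omega M))"
    and w': "a @ [(d, v')] @ b \<in> words (susp (Omega M))"
  then have v: "v \<in> piece (susp (Omega M)) d" "v' \<in> piece (susp (Omega M)) d"
    by (auto simp: words_def)
  then have "v + v' \<in> piece (susp (Omega M)) d"
    by (auto simp: piece_susp_Omega intro: fns_add split: if_splits)
  from words_update[OF w this] have w'': "a @ [(d, v + v')] @ b \<in> words (susp (Omega M))" .
  consider "a = []" "b = []" | "length (a @ [(d, v)] @ b) \<noteq> 1" "\<not> (\<forall>(d, \<omega>) \<in> set (a @ [(d, v)] @ b). d = 0)"
    | "d = 0" "\<forall>(d, \<omega>) \<in> set a \<union> set b. d = 0" by fastforce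
  then show "lambda_taylor M (a @ [(d, v + v')] @ b)
      = lambda_taylor M (a @ [(d, v)] @ b) + lambda_taylor M (a @ [(d, v')] @ b)"
  proof cases
    case 1
    with snd_mem_fns[OF v(1)] snd_mem_fns[OF v(2)] show ?thesis
      by (simp add: lambda_taylor_def whitney_proj_add)
  next
    case 2
    then have "lambda_taylor M (a @ [(d, x)] @ b) = 0" for x
      by (intro lambda_taylor_zero) auto
    then show ?thesis by simp
  next
    case 3
    then have *: "a @ [(0, x)] @ b \<in> words (susp (Omega M)) \<Longrightarrow> a @ [(0, x)] @ b \<in> one_form_words" for x
      by (subst one_form_words_iff) auto
    show ?thesis
      using *[of v] *[of v'] *[of "v + v'"] 3(1) w w' w''
      by (simp only: lambda_taylor_one_forms word_int_add whitney1_add)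
  qed
next
  fix a d v b c
  assume w: "a @ [(d, v)] @ b \<in> words (susp (Omega M))"
  then have v: "v \<in> piece (susp (Omega M)) d"
    by (auto simp: words_def)
  then have "form_scale M c v \<in> piece (susp (Omega M)) d"
    by (auto simp: piece_susp_Omega form_scale_def zero_prod_def intro: fns_smul split: if_splits)
  from words_update[OF w this] have w'': "a @ [(d, form_scale M c v)] @ b \<in> words (susp (Omega M))" .
  consider "a = []" "b = []" | "length (a @ [(d, v)] @ b) \<noteq> 1" "\<not> (\<forall>(d, \<omega>) \<in> set (a @ [(d, v)] @ b). d = 0)"
    | "d = 0" "\<forall>(d, \<omega>) \<in> set a \<union> set b. d = 0" by fastforce
  then show "lambda_taylor M (a @ [(d, form_scale M c v)] @ b)
      = form_scale M c (lambda_taylor M (a @ [(d, v)] @ b))"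
  proof cases
    case 1
    with snd_mem_fns[OF v] show ?thesis
      by (simp add: lambda_taylor_def whitney_proj_form_scale)
  next
    case 2
    then have "lambda_taylor M (a @ [(d, x)] @ b) = 0" for x
      by (intro lambda_taylor_zero) auto
    then show ?thesis by simp
  next
    case 3
    then have *: "a @ [(0, x)] @ b \<in> words (susp (Omega M)) \<Longrightarrow> a @ [(0, x)] @ b \<in> one_form_words" for x
      by (subst one_form_words_iff) auto
    show ?thesis
      using *[of v] *[of "form_scale M c v"] 3(1) w w''
      by (simp only: lambda_taylor_one_forms word_int_scale form_scale_whitney1)
  qed
qed

lemma log_taylor_degree_zero:
  assumes "length w \<noteq> 1" "\<forall>(d, \<omega>) \<in> set w. d = 0"
  shows "log_taylor M w = whitney1 M ((-1) ^ (length w + 1) / of_nat (length w)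
    * (\<Prod>(d, \<omega>)\<leftarrow>w. whitney1_coeff \<omega>))"
  unfolding log_taylor_def whitney1_coeff_def using assms by simp

lemma log_taylor_zero:
  "length w \<noteq> 1 \<Longrightarrow> \<not> (\<forall>(d, \<omega>) \<in> set w. d = 0) \<Longrightarrow> log_taylor M w = 0"
  unfolding log_taylor_def by (simp only: if_False)

lemma multilinear_log_taylor:
  "multilinear_on (susp (Whitney M)) (form_scale M) (log_taylor M)"
  unfolding multilinear_on_def scl_susp
proof (intro conjI allI impI)
  fix a d v v' b
  assume w: "a @ [(d, v)] @ b \<in> words (susp (Whitney M))"
    and w': "a @ [(d, v')] @ b \<in> words (susp (Whitney M))"
  then have v: "v \<in> piece (susp (Whitney M)) d" "v' \<in> piece (susp (Whitney M)) d"
    by (auto simp: words_def)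
  consider "a = []" "b = []" | "length (a @ [(d, v)] @ b) \<noteq> 1" "\<not> (\<forall>(d, \<omega>) \<in> set (a @ [(d, v)] @ b). d = 0)"
    | "length (a @ [(d, v)] @ b) \<noteq> 1" "\<forall>(d, \<omega>) \<in> set (a @ [(d, v)] @ b). d = 0" by fastforce
  then show "log_taylor M (a @ [(d, v + v')] @ b)
      = log_taylor M (a @ [(d, v)] @ b) + log_taylor M (a @ [(d, v')] @ b)"
  proof cases
    case 1
    then show ?thesis by (simp add: log_taylor_def)
  next
    case 2
    then have "log_taylor M (a @ [(d, x)] @ b) = 0" for x
      by (intro log_taylor_zero) auto
    then show ?thesis by simp
  next
    case 3
    then have "d = 0" by simp
    with v obtain c c' where "v = whitney1 M c" "v' = whitney1 M c'"
      by (auto simp: piece_susp_Whitney)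
    then have "whitney1_coeff (v + v') = whitney1_coeff v + whitney1_coeff v'"
      by (simp flip: whitney1_add)
    moreover have "log_taylor M (a @ [(d, x)] @ b) = whitney1 M ((-1) ^ (length (a @ [(d, v)] @ b) + 1)
        / of_nat (length (a @ [(d, v)] @ b)) * ((\<Prod>(d, \<omega>)\<leftarrow>a. whitney1_coeff \<omega>) * whitney1_coeff x
          * (\<Prod>(d, \<omega>)\<leftarrow>b. whitney1_coeff \<omega>)))" for x
      using 3 by (subst log_taylor_degree_zero) (auto simp: mult.assoc)
    ultimately show ?thesis
      by (simp only: distrib_left distrib_right whitney1_add)
  qed
next
  fix a d v b e
  assume w: "a @ [(d, v)] @ b \<in> words (susp (Whitney M))"
  then have v: "v \<in> piece (susp (Whitney M)) d"
    by (auto simp: words_def)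
  consider "a = []" "b = []" | "length (a @ [(d, v)] @ b) \<noteq> 1" "\<not> (\<forall>(d, \<omega>) \<in> set (a @ [(d, v)] @ b). d = 0)"
    | "length (a @ [(d, v)] @ b) \<noteq> 1" "\<forall>(d, \<omega>) \<in> set (a @ [(d, v)] @ b). d = 0" by fastforce
  then show "log_taylor M (a @ [(d, form_scale M e v)] @ b)
      = form_scale M e (log_taylor M (a @ [(d, v)] @ b))"
  proof cases
    case 1
    then show ?thesis by (simp add: log_taylor_def)
  next
    case 2
    then have "log_taylor M (a @ [(d, x)] @ b) = 0" for x
      by (intro log_taylor_zero) auto
    then show ?thesis by simp
  next
    case 3
    then have "d = 0" by simp
    with v obtain c where "v = whitney1 M c"
      by (auto simp: piece_susp_Whitney)
    then have "whitney1_coeff (form_scale M e v) = e * whitney1_coeff v"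
      by (simp add: form_scale_whitney1)
    moreover have "log_taylor M (a @ [(d, x)] @ b) = whitney1 M ((-1) ^ (length (a @ [(d, v)] @ b) + 1)
        / of_nat (length (a @ [(d, v)] @ b)) * ((\<Prod>(d, \<omega>)\<leftarrow>a. whitney1_coeff \<omega>) * whitney1_coeff x
          * (\<Prod>(d, \<omega>)\<leftarrow>b. whitney1_coeff \<omega>)))" for x
      using 3 by (subst log_taylor_degree_zero) (auto simp: mult.assoc)
    ultimately show ?thesis
      by (simp add: form_scale_whitney1 ac_simps)
  qed
qed

lemma lambda_taylor_degree:
  assumes "w \<in> words (susp (Omega M))"
  shows "lambda_taylor M w \<in> piece (susp (Whitney M)) (word_degree w)"
proof (cases "length w = 1")
  case True
  then obtain d v where w: "w = [(d, v)]" by (auto simp: length_Suc_conv)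
  with assms have "v \<in> piece (susp (Omega M)) d" by (simp add: words_def)
  with w show ?thesis
    by (auto simp: lambda_taylor_def word_degree_def piece_susp_Omega piece_susp_Whitney
        whitney_proj_def int01_zero eval_zero split: if_splits) blast
next
  case False
  with word_degree_zero[of w] show ?thesis
    by (auto simp: lambda_taylor_def zero_mem_piece_susp_Whitney) (auto simp: piece_susp_Whitney)
qed

lemma log_taylor_degree:
  assumes "w \<in> words (susp (Whitney M))"
  shows "log_taylor M w \<in> piece (susp (Whitney M)) (word_degree w)"
proof (cases "length w = 1")
  case True
  with assms show ?thesis
    by (auto simp: log_taylor_def word_degree_def length_Suc_conv words_def)
next
  case False
  with word_degree_zero[of w] show ?thesis
    by (auto simp: log_taylor_def zero_mem_piece_susp_Whitney) (auto simp: piece_susp_Whitney)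
qed

section \<open>Comparison of the two corestrictions\<close>

text \<open>For a word of one-forms this is Ree's identity.  Otherwise the right-hand side vanishes because every
  rearrangement of \<open>w\<close> still has a letter of nonzero degree.  On the left-hand side the degrees of
  the blocks may nevertheless all be zero, by cancellation within a block.  Such a block has at
  least two letters, one of nonzero degree, so its coefficient \<open>\<lambda>\<close> is zero and makes the product
  of coordinates zero.\<close>

lemma log_taylor_lambda_blocks:
  assumes w: "w \<in> words (susp (Omega M))" and k: "2 \<le> k" and ws: "ws \<in> cuts k w"
  shows "log_taylor M (map (\<lambda>b. (word_degree b, lambda_taylor M b)) ws)
    = form_scale M ((-1) ^ (k + 1) / of_nat k) (linear_eval (form_scale M) (lambda_taylor M) (shuffle_list ws))"
proof -
  let ?bs = "map (\<lambda>b. (word_degree b, lambda_taylor M b)) ws"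
  from ws k have len: "length ws = k" "ws \<noteq> []" and con: "concat ws = w" and ne: "[] \<notin> set ws"
    by (auto simp: cuts_def)
  have supp: "shuffle_list ws \<in> (supported_on (rearrangements (length w) (set w)) :: ('k, 'f \<times> 'f) formal set)"
    using shuffle_list_supported[OF len(2)] con by simp
  show ?thesis
  proof (cases "w \<in> one_form_words")
    case True
    then have blocks: "set ws \<subseteq> one_form_words"
      using con ne by (fastforce simp: one_form_words_def)
    have deg: "word_degree b = 0" if "b \<in> set ws" for b
      using that blocks by (intro word_degree_zero) (auto simp: one_form_words_def)
    have "log_taylor M ?bs = whitney1 M ((-1) ^ (k + 1) / of_nat k
        * (\<Prod>b\<leftarrow>ws. whitney1_coeff (lambda_taylor M b)))"
      using len k deg by (subst log_taylor_degree_zero) (auto simp: o_def)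
    also have "map (\<lambda>b. whitney1_coeff (lambda_taylor M b)) ws = map word_int ws"
      using blocks by (intro map_cong) (auto simp: lambda_taylor_one_forms)
    also have "prod_list (map word_int ws) = linear_eval (*) word_int (shuffle_list ws)"
      using word_int_shuffle_list[OF len(2) blocks] by simp
    also have "whitney1 M ((-1) ^ (k + 1) / of_nat k * linear_eval (*) word_int (shuffle_list ws))
        = form_scale M ((-1) ^ (k + 1) / of_nat k)
            (linear_eval (form_scale M) (\<lambda>z. whitney1 M (word_int z)) (shuffle_list ws))"
      by (simp only: linear_eval_def whitney1_sum form_scale_whitney1 flip: form_scale_whitney1)
    also have "linear_eval (form_scale M) (\<lambda>z. whitney1 M (word_int z)) (shuffle_list ws)
        = linear_eval (form_scale M) (lambda_taylor M) (shuffle_list ws)"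
    proof (rule linear_eval_cong)
      fix z assume "z \<in> Poly_Mapping.keys (shuffle_list ws :: ('k, 'f \<times> 'f) formal)"
      with supp have "z \<in> rearrangements (length w) (set w)" unfolding supported_on_def by blast
      with True have "z \<in> one_form_words" by (auto simp: rearrangements_def one_form_words_def)
      then show "whitney1 M (word_int z) = lambda_taylor M z" by (simp add: lambda_taylor_one_forms)
    qed
    finally show ?thesis .
  next
    case False
    then have nz: "\<not> (\<forall>(d, \<omega>) \<in> set w. d = 0)" using one_form_words_iff[OF w] by simp
    have "length w \<noteq> 1"
    proof
      assume "length w = 1"
      moreover have "length ws \<le> length (concat ws)"
        using ne by (induction ws) (auto simp: Suc_le_eq add_strict_increasing)
      ultimately show False using k len con by simp
    qed
    have "linear_eval (form_scale M) (lambda_taylor M) (shuffle_list ws)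
        = linear_eval (form_scale M) (\<lambda>_. 0) (shuffle_list ws)"
    proof (rule linear_eval_cong)
      fix z assume "z \<in> Poly_Mapping.keys (shuffle_list ws :: ('k, 'f \<times> 'f) formal)"
      with supp have "z \<in> rearrangements (length w) (set w)" unfolding supported_on_def by blast
      with nz \<open>length w \<noteq> 1\<close> show "lambda_taylor M z = 0"
        by (intro lambda_taylor_zero) (auto simp: rearrangements_def)
    qed
    then have rhs: "linear_eval (form_scale M) (lambda_taylor M) (shuffle_list ws) = 0"
      by (simp add: linear_eval_def)
    have "log_taylor M ?bs = 0"
    proof (cases "\<forall>(d, \<omega>) \<in> set ?bs. d = 0")
      case True
      from nz con obtain b d \<omega> where b: "b \<in> set ws" "(d, \<omega>) \<in> set b" "d \<noteq> 0" by auto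
      have "word_degree b = 0" using True b by auto
      then have "length b \<noteq> 1" using b by (auto simp: length_Suc_conv word_degree_def)
      then have "lambda_taylor M b = whitney1 M 0"
        using b by (subst lambda_taylor_zero) auto
      then have "whitney1_coeff (lambda_taylor M b) = 0" by (simp only: whitney1_coeff)
      then have "(\<Prod>(d, \<omega>)\<leftarrow>?bs. whitney1_coeff \<omega>) = 0"
        using b by (auto simp: prod_list_zero_iff o_def)
      moreover have "log_taylor M ?bs = whitney1 M ((-1) ^ (length ?bs + 1) / of_nat (length ?bs)
          * (\<Prod>(d, \<omega>)\<leftarrow>?bs. whitney1_coeff \<omega>))"
        using True len k by (intro log_taylor_degree_zero) auto
      ultimately show ?thesis by (simp only: mult_zero_right whitney1_zero)
    next
      case False
      then show ?thesis using len k by (intro log_taylor_zero) auto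
    qed
    with rhs show ?thesis by simp
  qed
qed

text \<open>Both sides are sums over the cuts of \<open>w\<close>; the trivial cut gives the summand \<open>w\<close> of \<open>E\<^sup>*\<close>, and the
  logarithm fixes single letters.\<close>

lemma log_lambda_word_eq_lambda_eulerian_adj:
  assumes w: "w \<in> words (susp (Omega M))"
  shows "linear_eval (form_scale M) (log_taylor M)
      (\<Sum>k=1..length w. \<Sum>ws\<in>cuts k w. fword (map (\<lambda>b. (word_degree b, lambda_taylor M b)) ws))
    = linear_eval (form_scale M) (lambda_taylor M) (eulerian_adj_word w)"
proof -
  have ne: "w \<noteq> []" using w by (simp add: words_def)
  interpret L: module_hom fscale "form_scale M" "linear_eval (form_scale M) (log_taylor M)"
    by (rule module_hom_linear_eval[OF module_form_scale])
  interpret lam: module_hom fscale "form_scale M" "linear_eval (form_scale M) (lambda_taylor M)"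
    by (rule module_hom_linear_eval[OF module_form_scale])
  let ?log = "\<lambda>ws. log_taylor M (map (\<lambda>b. (word_degree b, lambda_taylor M b)) ws)"
  have "linear_eval (form_scale M) (log_taylor M)
      (\<Sum>k=1..length w. \<Sum>ws\<in>cuts k w. fword (map (\<lambda>b. (word_degree b, lambda_taylor M b)) ws))
    = (\<Sum>k=1..length w. \<Sum>ws\<in>cuts k w. ?log ws)"
    by (simp only: L.sum linear_eval_fword[OF module_form_scale])
  also have "\<dots> = (\<Sum>ws\<in>cuts 1 w. ?log ws) + (\<Sum>k=2..length w. \<Sum>ws\<in>cuts k w. ?log ws)"
    using ne by (subst sum.atLeast_Suc_atMost) (auto simp: Suc_le_eq numeral_2_eq_2)
  also have "(\<Sum>ws\<in>cuts 1 w. ?log ws) = lambda_taylor M w"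
    using cuts_one[OF ne] by (simp add: log_taylor_def)
  also have "(\<Sum>k=2..length w. \<Sum>ws\<in>cuts k w. ?log ws)
      = (\<Sum>k=2..length w. form_scale M ((-1) ^ (k + 1) / of_nat k)
          (\<Sum>ws\<in>cuts k w. linear_eval (form_scale M) (lambda_taylor M) (shuffle_list ws)))"
    unfolding form.scale_sum_right
    by (intro sum.cong refl log_taylor_lambda_blocks[OF w]) auto
  also have "lambda_taylor M w + \<dots> = linear_eval (form_scale M) (lambda_taylor M) (eulerian_adj_word w)"
    by (simp only: eulerian_adj_word_def lam.add lam.sum lam.scale linear_eval_fword[OF module_form_scale])
  finally show ?thesis .
qed

theorem corestriction_phi_eq:
  assumes X: "X \<in> Tbar (susp (Omega M))"
  shows "corestriction (susp (Whitney M)) (phi_morphism M) X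
    = (corestriction (susp (Whitney M)) (lambda_morphism M) \<circ> eulerian_adj (susp (Omega M))) X"
proof -
  let ?V = "susp (Omega M)" and ?W = "susp (Whitney M)"
  let ?lam = "\<lambda>w. \<Sum>k=1..length w. \<Sum>ws\<in>cuts k w.
    fword (map (\<lambda>b. (word_degree b, lambda_taylor M b)) ws) :: ('k, 'f \<times> 'f) formal"
  have X: "X \<subseteq> formal_space ?V" using Tbar_subset_formal_space[OF X] .
  have lam: "lin_ext ?lam x \<in> formal_space ?W" if "x \<in> X" for x
    using that X unfolding formal_space_eq_supported_on
    by (intro supported_on_coalg_morphism[where V = ?V] lambda_taylor_degree) auto
  have eul: "lin_ext eulerian_adj_word x \<in> formal_space ?V" if "x \<in> X" for x
    unfolding formal_space_eq_supported_on
  proof (rule supported_on_lin_ext)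
    show "x \<in> supported_on (words ?V)" using that X by (auto simp: formal_space_eq_supported_on)
    fix w assume "w \<in> words ?V"
    then have "rearrangements (length w) (set w) \<subseteq> words ?V"
      by (auto simp: rearrangements_def words_def)
    with eulerian_adj_word_supported[of w, where 'k = 'k]
    show "eulerian_adj_word w \<in> (supported_on (words ?V) :: ('k, 'f \<times> 'f) formal set)"
      unfolding supported_on_def by blast
  qed
  have "corestriction ?W (phi_morphism M) X
      = corestriction ?W (coalg_morphism ?W (log_taylor M)) (tensor_map ?W ?lam X)"
    by (simp add: phi_morphism_def log_morphism_def lambda_morphism_def corestriction_def
        coalg_morphism_def)
  also have "\<dots> = the_elem (linear_eval (form_scale M) (log_taylor M) ` tensor_map ?W ?lam X)"
    by (subst the_elem_corestriction_coalg_morphism[where V = ?W])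
      (simp_all add: module_form_scale log_taylor_degree tensor_map_subset_formal_space)
  also have "linear_eval (form_scale M) (log_taylor M) ` tensor_map ?W ?lam X
      = (\<lambda>x. linear_eval (form_scale M) (log_taylor M) (lin_ext ?lam x)) ` X"
    by (rule image_linear_eval_tensor_map[OF module_form_scale multilinear_log_taylor lam])
  also have "\<dots> = (\<lambda>x. linear_eval (form_scale M) (lambda_taylor M) (lin_ext eulerian_adj_word x)) ` X"
  proof (rule image_cong[OF refl])
    fix x assume "x \<in> X"
    with X have "Poly_Mapping.keys x \<subseteq> words ?V" by (auto simp: formal_space_def)
    then show "linear_eval (form_scale M) (log_taylor M) (lin_ext ?lam x)
        = linear_eval (form_scale M) (lambda_taylor M) (lin_ext eulerian_adj_word x)"
      unfolding linear_eval_lin_ext[OF module_form_scale]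
      by (intro linear_eval_cong log_lambda_word_eq_lambda_eulerian_adj) auto
  qed
  also have "\<dots> = linear_eval (form_scale M) (lambda_taylor M) ` tensor_map ?V eulerian_adj_word X"
    by (rule image_linear_eval_tensor_map[OF module_form_scale multilinear_lambda_taylor eul, symmetric])
  also have "the_elem \<dots> = corestriction ?W (lambda_morphism M) (tensor_map ?V eulerian_adj_word X)"
    unfolding lambda_morphism_def
    by (subst the_elem_corestriction_coalg_morphism[where V = ?V])
      (simp_all add: module_form_scale lambda_taylor_degree tensor_map_subset_formal_space)
  finally show ?thesis by (simp add: eulerian_adj_def)
qed

end

section \<open>Polynomial forms\<close>

lemma coeff_poly_primitive:
  "coeff (poly_primitive p) n = (if n = 0 then 0 else coeff p (n - 1) / of_nat n)"
proof (cases n)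
  case 0
  then show ?thesis by (simp add: poly_primitive_def coeff_sum)
next
  case (Suc m)
  have "coeff (poly_primitive p) n = (\<Sum>i\<le>degree p. if i = m then coeff p m / of_nat n else 0)"
    unfolding poly_primitive_def coeff_sum using Suc by (intro sum.cong) (auto simp: add.commute)
  also have "\<dots> = coeff p m / of_nat n"
    by (simp add: coeff_eq_0)
  finally show ?thesis using Suc by simp
qed

lemma pderiv_poly_primitive: "pderiv (poly_primitive p) = p"
  by (rule poly_eqI) (simp add: coeff_pderiv coeff_poly_primitive del: of_nat_Suc)

text \<open>In characteristic zero the derivative determines a polynomial up to its constant coefficient.\<close>

lemma poly_primitive_unique:
  fixes p :: "'k::field_char_0 poly"
  assumes "pderiv p = q" "coeff p 0 = 0"
  shows "p = poly_primitive q"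
proof (rule poly_eqI)
  fix n
  show "coeff p n = coeff (poly_primitive q) n"
    using assms by (cases n) (auto simp: coeff_pderiv coeff_poly_primitive simp del: of_nat_Suc)
qed

lemma poly_primitive_Rota_Baxter:
  "poly_primitive f * poly_primitive g
    = poly_primitive (f * poly_primitive g) + poly_primitive (poly_primitive f * g)"
proof -
  have add: "poly_primitive p + poly_primitive q = poly_primitive (p + q)" for p q :: "'a poly"
    by (rule poly_eqI) (simp add: coeff_poly_primitive add_divide_distrib)
  show ?thesis
    unfolding add
    by (rule poly_primitive_unique)
      (simp_all add: pderiv_mult pderiv_poly_primitive coeff_mult_0 coeff_poly_primitive algebra_simps)
qed

lemma iterated_integrals_poly:
  "iterated_integrals (poly_functions :: ('k::field_char_0, 'k poly) functions01) UNIV poly_primitive"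
proof
  fix as :: "'k poly list"
  show "simplex_int poly_functions as
      = eval_fn poly_functions (foldl (\<lambda>P a. poly_primitive (a * P)) 1 as) 1"
    by (simp add: poly_functions_def)
qed (auto simp: poly_functions_def smult_add_right smult_add_left poly_primitive_Rota_Baxter
    coeff_poly_primitive add_divide_distrib intro: poly_eqI)

section \<open>Smooth forms\<close>

text \<open>Setting the primitive to zero outside \<open>[0,1]\<close> lets the Rota-Baxter equation hold as an equation
  between functions on the whole line.\<close>

definition primitive01 :: "(real \<Rightarrow> real) \<Rightarrow> real \<Rightarrow> real" where
  "primitive01 f x = (if x \<in> {0..1} then integral {0..x} f else 0)"

lemma continuous_on_primitive01:
  assumes "continuous_on {0..1} f"
  shows "continuous_on {0..1} (primitive01 f)"
proof -
  have "continuous_on {0..1} (\<lambda>x. integral {0..x} f)"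
    by (intro indefinite_integral_continuous_1 integrable_continuous_real assms)
  then show ?thesis
    by (rule continuous_on_eq) (simp add: primitive01_def)
qed

lemma integrable_subinterval01:
  "continuous_on {0..1} f \<Longrightarrow> x \<le> 1 \<Longrightarrow> f integrable_on {0..x::real}" for f :: "real \<Rightarrow> real"
  by (intro integrable_continuous_real) (auto elim: continuous_on_subset)

lemma primitive01_add:
  assumes "continuous_on {0..1} f" "continuous_on {0..1} g"
  shows "primitive01 (f + g) = primitive01 f + primitive01 g"
  using assms by (auto simp: fun_eq_iff primitive01_def plus_fun_def intro!: integral_add integrable_subinterval01)

lemma primitive01_scale: "primitive01 (\<lambda>x. c * f x) = (\<lambda>x. c * primitive01 f x)"
  by (auto simp: fun_eq_iff primitive01_def)

lemma primitive01_Rota_Baxter: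
  assumes f: "continuous_on {0..1} f" and g: "continuous_on {0..1} g"
  shows "primitive01 f * primitive01 g = primitive01 (f * primitive01 g) + primitive01 (primitive01 f * g)"
proof
  fix x :: real
  show "(primitive01 f * primitive01 g) x = (primitive01 (f * primitive01 g) + primitive01 (primitive01 f * g)) x"
  proof (cases "x \<in> {0..1}")
    case True
    \<comment> \<open>The fundamental theorem for the product of the two primitives.\<close>
    let ?F = "\<lambda>t. integral {0..t} f" and ?G = "\<lambda>t. integral {0..t} g"
    have "((\<lambda>t. f t * ?G t + ?F t * g t) has_integral (?F x * ?G x - ?F 0 * ?G 0)) {0..x}"
    proof (rule fundamental_theorem_of_calculus)
      fix t assume t: "t \<in> {0..x}"
      have "((\<lambda>t. ?F t * ?G t) has_real_derivative ?F t * g t + f t * ?G t) (at t within {0..1})"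
        using t True by (intro DERIV_mult' integral_has_real_derivative f g) auto
      then show "((\<lambda>t. ?F t * ?G t) has_vector_derivative f t * ?G t + ?F t * g t) (at t within {0..x})"
        using True by (simp add: has_real_derivative_iff_has_vector_derivative add.commute
            has_vector_derivative_within_subset[where T = "{0..x}"])
    qed (use True in auto)
    then have "?F x * ?G x = integral {0..x} (\<lambda>t. f t * ?G t + ?F t * g t)"
      by (simp add: integral_unique)
    also have "\<dots> = integral {0..x} (f * primitive01 g + primitive01 f * g)"
      using True by (intro integral_cong) (auto simp: primitive01_def)
    also have "\<dots> = primitive01 (f * primitive01 g + primitive01 f * g) x"
      using True by (simp add: primitive01_def)
    also have "\<dots> = primitive01 (f * primitive01 g) x + primitive01 (primitive01 f * g) x"
      by (subst primitive01_add)
        (auto simp: times_fun_def intro!: continuous_on_mult f g continuous_on_primitive01)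
    finally show ?thesis using True by (simp add: primitive01_def)
  qed (auto simp: primitive01_def)
qed

text \<open>The nested primitives, kept opaque so that pointwise products of functions are not expanded inside
  the iteration.\<close>

definition iterated01 :: "(real \<Rightarrow> real) list \<Rightarrow> real \<Rightarrow> real" where
  "iterated01 as = foldl (\<lambda>P a. primitive01 (a * P)) 1 as"

lemma iterated01_snoc: "iterated01 (as @ [a]) = primitive01 (\<lambda>x. a x * iterated01 as x)"
  by (simp add: iterated01_def times_fun_def)

lemma continuous_on_iterated01:
  "(\<And>a. a \<in> set as \<Longrightarrow> continuous_on {0..1} a) \<Longrightarrow> continuous_on {0..1} (iterated01 as)"
proof (induction as rule: rev_induct)
  case Nil
  show ?case by (simp add: iterated01_def one_fun_def)
next
  case (snoc a as)
  then show ?case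
    unfolding iterated01_snoc by (intro continuous_on_primitive01 continuous_on_mult) simp_all
qed

text \<open>A variable upper bound \<open>x\<close> is needed for induction: fixing the last coordinate \<open>y\<close> of the
  simplex leaves the simplex of one dimension less with upper bound \<open>y\<close>.\<close>

definition scaled_simplex :: "nat \<Rightarrow> real \<Rightarrow> (nat \<Rightarrow> real) set" where
  "scaled_simplex n x = {t \<in> {..<n} \<rightarrow>\<^sub>E UNIV.
     (\<forall>i<n. 0 \<le> t i \<and> t i \<le> x) \<and> (\<forall>i j. i \<le> j \<and> j < n \<longrightarrow> t i \<le> t j)}"

lemma space_PiM_lborel: "space (PiM I (\<lambda>_. lborel)) = I \<rightarrow>\<^sub>E UNIV"
  by (simp add: space_PiM)

lemma sets_scaled_simplex: "scaled_simplex n x \<in> sets (PiM {..<n} (\<lambda>_. lborel))"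
proof -
  let ?P = "PiM {..<n} (\<lambda>_. lborel) :: (nat \<Rightarrow> real) measure"
  have comp: "(\<lambda>t. t i) \<in> borel_measurable ?P" if "i < n" for i
    using measurable_component_singleton[of i "{..<n}" "\<lambda>_. lborel"] that by simp
  have "scaled_simplex n x = {t \<in> space ?P. (\<forall>i\<in>{..<n}. 0 \<le> t i \<and> t i \<le> x) \<and>
      (\<forall>j\<in>{..<n}. \<forall>i\<in>{..j}. t i \<le> t j)}"
    by (auto simp: scaled_simplex_def space_PiM_lborel)
  also have "\<dots> \<in> sets ?P"
    using comp
    by (intro sets.sets_Collect_conj sets.sets_Collect_finite_All borel_measurable_le) auto
  finally show ?thesis .
qed

lemma integrable_simplex:
  fixes as :: "(real \<Rightarrow> real) list"
  assumes "\<And>a. a \<in> set as \<Longrightarrow> continuous_on {0..1} a" "x \<le> 1" "n = length as"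
  shows "integrable (PiM {..<n} (\<lambda>_. lborel))
    (\<lambda>t. indicator (scaled_simplex n x) t *\<^sub>R (\<Prod>i<n. (as ! i) (t i)))"
proof -
  interpret product_sigma_finite "\<lambda>_ :: nat. lborel :: real measure"
    by (simp add: product_sigma_finite_def sigma_finite_lborel)
  have "integrable (PiM {..<n} (\<lambda>_. lborel)) (\<lambda>t. \<Prod>i<n. indicator {0..1} (t i) *\<^sub>R (as ! i) (t i))"
  proof (rule product_integrable_prod[where f = "\<lambda>i y. indicator {0..1} y *\<^sub>R (as ! i) y"])
    show "integrable lborel (\<lambda>y. indicator {0..1} y *\<^sub>R (as ! i) y)" if "i \<in> {..<n}" for i
      using assms that by (intro borel_integrable_compact) auto
  qed simp
  then have "integrable (PiM {..<n} (\<lambda>_. lborel)) (\<lambda>t. indicator (scaled_simplex n x) t *\<^sub>R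
      (\<Prod>i<n. indicator {0..1} (t i) *\<^sub>R (as ! i) (t i)))"
    by (rule integrable_mult_indicator[OF sets_scaled_simplex])
  also have "(\<lambda>t. indicator (scaled_simplex n x) t *\<^sub>R (\<Prod>i<n. indicator {0..1} (t i) *\<^sub>R (as ! i) (t i)))
      = (\<lambda>t. indicator (scaled_simplex n x) t *\<^sub>R (\<Prod>i<n. (as ! i) (t i)))"
    using assms(2) by (fastforce simp: fun_eq_iff scaled_simplex_def split: split_indicator intro!: prod.cong)
  finally show ?thesis .
qed

lemma merge_mem_scaled_simplex:
  assumes t: "t \<in> {..<n} \<rightarrow>\<^sub>E UNIV"
  shows "merge {n} {..<n} (z, t) \<in> scaled_simplex (Suc n) x \<longleftrightarrow> z n \<in> {0..x} \<and> t \<in> scaled_simplex n (z n)"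
proof -
  have n: "merge {n} {..<n} (z, t) n = z n" and lt: "\<And>i. i < n \<Longrightarrow> merge {n} {..<n} (z, t) i = t i"
    by (simp_all add: merge_def)
  have ext: "merge {n} {..<n} (z, t) \<in> {..<Suc n} \<rightarrow>\<^sub>E UNIV"
    by (auto simp: merge_def PiE_def extensional_def)
  show ?thesis
  proof
    assume L: "merge {n} {..<n} (z, t) \<in> scaled_simplex (Suc n) x"
    have bound: "0 \<le> merge {n} {..<n} (z, t) i \<and> merge {n} {..<n} (z, t) i \<le> x" if "i < Suc n" for i
      using L that unfolding scaled_simplex_def by blast
    have mono: "merge {n} {..<n} (z, t) i \<le> merge {n} {..<n} (z, t) j" if "i \<le> j" "j < Suc n" for i j
      using L that unfolding scaled_simplex_def by blast
    have "z n \<in> {0..x}" using bound[of n] by (simp add: n)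
    moreover have "0 \<le> t i \<and> t i \<le> z n" if "i < n" for i
      using bound[of i] mono[of i n] that by (simp add: n lt)
    moreover have "t i \<le> t j" if "i \<le> j" "j < n" for i j
      using mono[of i j] that by (simp add: lt)
    ultimately show "z n \<in> {0..x} \<and> t \<in> scaled_simplex n (z n)"
      using t unfolding scaled_simplex_def by blast
  next
    assume R: "z n \<in> {0..x} \<and> t \<in> scaled_simplex n (z n)"
    then have bound: "0 \<le> t i \<and> t i \<le> z n" if "i < n" for i
      using that unfolding scaled_simplex_def by blast
    have mono: "t i \<le> t j" if "i \<le> j" "j < n" for i j
      using R that unfolding scaled_simplex_def by blast
    have "0 \<le> merge {n} {..<n} (z, t) i \<and> merge {n} {..<n} (z, t) i \<le> x" if "i < Suc n" for i
      using R bound[of i] that by (cases "i = n") (auto simp: n lt)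
    \<comment> \<open>The largest coordinate is the one at position \<open>n\<close>; it dominates by the bound on \<open>t\<close>.\<close>
    moreover have "merge {n} {..<n} (z, t) i \<le> merge {n} {..<n} (z, t) j" if "i \<le> j" "j < Suc n" for i j
      using mono[of i j] bound[of i] that by (cases "i = j"; cases "j = n") (auto simp: n lt)
    ultimately show "merge {n} {..<n} (z, t) \<in> scaled_simplex (Suc n) x"
      using ext unfolding scaled_simplex_def by blast
  qed
qed

text \<open>By Fubini the last coordinate is integrated outermost, over \<open>[0,x]\<close>, and the induction hypothesis
  evaluates the slices, which are simplices again by \<open>merge_mem_scaled_simplex\<close>.\<close>

lemma simplex_integral_eq_iterated:
  assumes "\<And>a. a \<in> set as \<Longrightarrow> continuous_on {0..1} a" "x \<in> {0..1}"
  shows "(LINT t:scaled_simplex (length as) x|PiM {..<length as} (\<lambda>_. lborel). \<Prod>i<length as. (as ! i) (t i))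
    = iterated01 as x"
  using assms
proof (induction as arbitrary: x rule: rev_induct)
  case Nil
  interpret product_sigma_finite "\<lambda>_ :: nat. lborel :: real measure"
    by (simp add: product_sigma_finite_def sigma_finite_lborel)
  show ?case
    by (simp add: set_lebesgue_integral_def PiM_empty lebesgue_integral_count_space_finite
        scaled_simplex_def iterated01_def)
next
  case (snoc a as)
  interpret product_sigma_finite "\<lambda>_ :: nat. lborel :: real measure"
    by (simp add: product_sigma_finite_def sigma_finite_lborel)
  define n where "n = length as"
  let ?I = "iterated01 as"
  let ?F = "\<lambda>t. indicator (scaled_simplex (Suc n) x) t *\<^sub>R (\<Prod>i<Suc n. ((as @ [a]) ! i) (t i))"
  have cont: "continuous_on {0..1} ?I"
    using snoc.prems(1) by (intro continuous_on_iterated01) simp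
  have cont_x: "continuous_on {0..x} (\<lambda>y. a y * ?I y)"
    by (rule continuous_on_subset[of "{0..1}"])
      (use snoc.prems cont in \<open>auto intro!: continuous_on_mult\<close>)
  have int: "integrable (PiM ({n} \<union> {..<n}) (\<lambda>_. lborel)) ?F"
    using integrable_simplex[of "as @ [a]" x "Suc n"] snoc.prems
    by (simp add: n_def lessThan_Suc)
  have inner: "(\<integral>t. ?F (merge {n} {..<n} (z, t)) \<partial>PiM {..<n} (\<lambda>_. lborel))
      = indicator {0..x} (z n) *\<^sub>R (a (z n) * ?I (z n))" for z :: "nat \<Rightarrow> real"
  proof -
    have "(\<integral>t. ?F (merge {n} {..<n} (z, t)) \<partial>PiM {..<n} (\<lambda>_. lborel))
        = (\<integral>t. (indicator {0..x} (z n) * a (z n)) *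
            (indicator (scaled_simplex n (z n)) t *\<^sub>R (\<Prod>i<n. (as ! i) (t i))) \<partial>PiM {..<n} (\<lambda>_. lborel))"
    proof (rule Bochner_Integration.integral_cong[OF refl])
      fix t assume "t \<in> space (PiM {..<n} (\<lambda>_. lborel :: real measure))"
      then have t: "t \<in> {..<n} \<rightarrow>\<^sub>E UNIV" by (simp add: space_PiM_lborel)
      have "(\<Prod>i<Suc n. ((as @ [a]) ! i) (merge {n} {..<n} (z, t) i)) = (\<Prod>i<n. (as ! i) (t i)) * a (z n)"
        by (simp add: n_def nth_append merge_def)
      then show "?F (merge {n} {..<n} (z, t)) = (indicator {0..x} (z n) * a (z n)) *
            (indicator (scaled_simplex n (z n)) t *\<^sub>R (\<Prod>i<n. (as ! i) (t i)))"
        using merge_mem_scaled_simplex[OF t, of z x] by (simp split: split_indicator)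
    qed
    also have "\<dots> = (indicator {0..x} (z n) * a (z n)) *
        (LINT t:scaled_simplex n (z n)|PiM {..<n} (\<lambda>_. lborel). \<Prod>i<n. (as ! i) (t i))"
      by (simp add: set_lebesgue_integral_def)
    also have "\<dots> = indicator {0..x} (z n) *\<^sub>R (a (z n) * ?I (z n))"
      using snoc.IH[of "z n"] snoc.prems by (auto simp: n_def split: split_indicator)
    finally show ?thesis .
  qed
  have "(LINT t:scaled_simplex (length (as @ [a])) x|PiM {..<length (as @ [a])} (\<lambda>_. lborel).
      \<Prod>i<length (as @ [a]). ((as @ [a]) ! i) (t i)) = (\<integral>t. ?F t \<partial>PiM ({n} \<union> {..<n}) (\<lambda>_. lborel))"
    by (simp add: set_lebesgue_integral_def n_def lessThan_Suc)
  \<comment> \<open>Putting \<open>{n}\<close> first makes the last coordinate the outer variable.\<close>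
  also have "\<dots> = (\<integral>z. (\<integral>t. ?F (merge {n} {..<n} (z, t)) \<partial>PiM {..<n} (\<lambda>_. lborel)) \<partial>PiM {n} (\<lambda>_. lborel))"
    by (rule product_integral_fold[OF _ _ _ int]) auto
  also have "\<dots> = (\<integral>z. indicator {0..x} (z n) *\<^sub>R (a (z n) * ?I (z n)) \<partial>PiM {n} (\<lambda>_. lborel))"
    by (simp only: inner)
  also have "\<dots> = (\<integral>y. indicator {0..x} y *\<^sub>R (a y * ?I y) \<partial>lborel)"
  proof (rule product_integral_singleton)
    show "(\<lambda>y. indicator {0..x} y *\<^sub>R (a y * ?I y)) \<in> borel_measurable lborel"
      by (intro borel_measurable_integrable borel_integrable_compact cont_x) simp
  qed
  also have "\<dots> = integral {0..x} (\<lambda>y. a y * ?I y)"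
    unfolding set_lebesgue_integral_def[symmetric]
    by (intro set_borel_integral_eq_integral(2))
      (unfold set_integrable_def, rule borel_integrable_compact, simp_all add: cont_x)
  also have "\<dots> = iterated01 (as @ [a]) x"
    using snoc.prems by (simp add: primitive01_def iterated01_snoc)
  finally show ?case .
qed

lemma continuous_on_smooth01: "f \<in> smooth01 \<Longrightarrow> continuous_on {0..1} f"
  unfolding smooth01_def by (blast intro: DERIV_continuous_on)

lemma smooth01_add: 
  assumes "f \<in> smooth01" "g \<in> smooth01" shows "f + g \<in> smooth01"
proof -
  from assms obtain D E where "D 0 = f" "E 0 = g"
    "\<And>n x. x \<in> {0..1} \<Longrightarrow> (D n has_real_derivative D (Suc n) x) (at x within {0..1})"
    "\<And>n x. x \<in> {0..1} \<Longrightarrow> (E n has_real_derivative E (Suc n) x) (at x within {0..1})"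
    unfolding smooth01_def by blast
  then show ?thesis
    using assms unfolding smooth01_def
    by (auto simp: plus_fun_def intro!: exI[of _ "\<lambda>n x. D n x + E n x"] DERIV_add)
qed

lemma smooth01_scale: 
  assumes "f \<in> smooth01" shows "(\<lambda>x. c * f x) \<in> smooth01"
proof -
  from assms obtain D where "D 0 = f"
    "\<And>n x. x \<in> {0..1} \<Longrightarrow> (D n has_real_derivative D (Suc n) x) (at x within {0..1})"
    unfolding smooth01_def by blast
  then show ?thesis
    using assms unfolding smooth01_def
    by (auto intro!: exI[of _ "\<lambda>n x. c * D n x"] DERIV_cmult)
qed

lemma iterated_integrals_smooth:
  "iterated_integrals smooth_functions {f. continuous_on {0..1} f} primitive01"
proof
  show "0 \<in> fns smooth_functions"
    by (auto simp: smooth_functions_def smooth01_def intro!: exI[of _ "\<lambda>_ _. 0"])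
next
  show "unit_fn smooth_functions \<noteq> 0"
    by (auto simp: smooth_functions_def fun_eq_iff intro!: exI[of _ 0])
next
  show "int01 smooth_functions a = eval_fn smooth_functions (primitive01 a) 1" for a
    by (simp add: smooth_functions_def primitive01_def)
next
  show "simplex_int smooth_functions as
      = eval_fn smooth_functions (foldl (\<lambda>P a. primitive01 (a * P)) 1 as) 1"
    if "set as \<subseteq> fns smooth_functions" for as
  proof -
    have "ordered_simplex n = scaled_simplex n 1" for n
      by (simp add: ordered_simplex_def scaled_simplex_def)
    then show ?thesis
      using that simplex_integral_eq_iterated[of as 1] continuous_on_smooth01
      by (auto simp: smooth_functions_def iterated01_def Let_def)
  qed
qed (auto simp: smooth_functions_def plus_fun_def times_fun_def one_fun_def
    primitive01_add[unfolded plus_fun_def] primitive01_scale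
    primitive01_Rota_Baxter[unfolded plus_fun_def times_fun_def] fun_eq_iff algebra_simps
    intro: smooth01_scale smooth01_add[unfolded plus_fun_def] continuous_on_smooth01
    continuous_on_primitive01 intro!: continuous_on_add continuous_on_mult)

section \<open>The corestriction of the logarithm composed with iterated integration\<close>

theorem proposition2p6:
  shows "(\<forall>X \<in> Tbar (susp (Omega (poly_functions :: ('k::field_char_0, 'k poly) functions01))).
            corestriction (susp (Whitney poly_functions)) (phi_morphism poly_functions) X
          = (corestriction (susp (Whitney poly_functions)) (lambda_morphism poly_functions)
               \<circ> eulerian_adj (susp (Omega poly_functions))) X)
       \<and> (\<forall>X \<in> Tbar (susp (Omega smooth_functions)).
            corestriction (susp (Whitney smooth_functions)) (phi_morphism smooth_functions) X
          = (corestriction (susp (Whitney smooth_functions)) (lambda_morphism smooth_functions)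
               \<circ> eulerian_adj (susp (Omega smooth_functions))) X)"
proof -
  interpret poly: iterated_integrals "poly_functions :: ('k, 'k poly) functions01" UNIV poly_primitive
    by (rule iterated_integrals_poly)
  interpret smooth: iterated_integrals smooth_functions "{f. continuous_on {0..1} f}" primitive01
    by (rule iterated_integrals_smooth)
  show ?thesis
    using poly.corestriction_phi_eq smooth.corestriction_phi_eq by blast
qed

end
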